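(* Let $p,q$ be primes such that $q$ divides $(p^p-1)/(p-1)$, and let $B=(N,\cdot,\circ)$ be the skew brace of order $p^pq$ corresponding to the regular subgroup $G=\langle X,Y_{e_{p-1}},Z\rangle$ of $\mathrm{Hol}(N)$ defined in the context. Then the group $\mathrm{Aut}_{\mathrm{sb}}(B)$ of skew brace automorphisms of $B$ has order $p$ and is generated by the automorphism of $(B,\cdot)=N$ given by conjugation by the block matrix $$\begin{pmatrix}J&0\\0&1\end{pmatrix}.$$
   Context: Skew braces: a skew brace $(B,\cdot,\circ)$ is a set with two group operations satisfying $a\circ(b\cdot c)=(a\circ b)\cdot a^{-1}\cdot(a\circ c)$, with $a^{-1}$ the inverse in $(B,\cdot)$. A skew brace automorphism is a bijection $B\to B$ respecting both operations. Holomorph: for a group $N$, $\mathrm{Hol}(N)=N\rtimes\mathrm{Aut}(N)$ acts on the set $N$ by $(\eta,\alpha)\mu=\eta\alpha(\mu)$, with multiplication $(\eta,\alpha)(\mu,\beta)=(\eta\alpha(\mu),\alpha\beta)$. A subgroup $G$ is regular if for all $\eta,\mu\in N$ there is a unique $g\in G$ with $g\eta=\mu$. A regular $G$ contains, for each $\eta\in N$, a unique element $g_\eta$ with first component $\eta$, and gives the skew brace $(N,\cdot,\circ)$ where $\circ$ is defined by $g_{\eta\circ\eta'}=g_\eta g_{\eta'}$. Notation: $V=\mathbb{F}_p^p$ (column vectors) with standard basis $e_1,\dots,e_p$. $J\in\mathrm{GL}_p(\mathbb{F}_p)$ is the Jordan matrix with $Je_1=e_1$ and $Je_i=e_i+e_{i-1}$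 for $2\le i\le p$. $M\in\mathrm{GL}_p(\mathbb{F}_p)$ is a fixed matrix of order $q$ with $JMJ^{-1}=M^p$ (such an $M$ exists). $N$ is the group, of order $p^pq$, of block matrices $\begin{pmatrix}M^k&v\\0&1\end{pmatrix}\in\mathrm{GL}_{p+1}(\mathbb{F}_p)$ with $0\le k\le q-1$, $v\in V$. If $A\in\mathrm{GL}_p(\mathbb{F}_p)$ normalises $\langle M\rangle$ and $w\in V$, then conjugation by $S=\begin{pmatrix}A&w\\0&1\end{pmatrix}$ is an automorphism $\mathrm{conj}(S)$ of $N$. Elements of $\mathrm{Hol}(N)$ are written $[R,\mathrm{conj}(S)]$ with $R\in N$. Define $$X=\left[\begin{pmatrix}M&0\\0&1\end{pmatrix},\mathrm{conj}\begin{pmatrix}I&0\\0&1\end{pmatrix}\right],\quad Y_v=\left[\begin{pmatrix}I&v\\0&1\end{pmatrix},\mathrm{conj}\begin{pmatrix}I&-v\\0&1\end{pmatrix}\right]\ (v\in V),$$ $$Z=\left[\begin{pmatrix}I&e_p\\0&1\end{pmatrix},\mathrm{conj}\begin{pmatrix}J&-e_p\\0&1\end{pmatrix}\right],$$ and $G=\langle X,Y_{e_{p-1}},Z\rangle\le\mathrm{Hol}(N)$, which is a regular subgroup of $\mathrm{Hol}(N)$. The resulting skew brace $B$ is simple. *)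

theory Defs
  imports
    "HOL-Algebra.Algebra"
    "Jordan_Normal_Form.Jordan_Normal_Form"
    "Berlekamp_Zassenhaus.Finite_Field"
begin

text \<open>A skew brace is a pair of groups \<open>A\<close> (the operation written with a dot) and \<open>C\<close>
  (the operation written with a circle) on the same carrier set.\<close>

locale skew_brace = A: group A + C: group C
  for A :: "'a monoid" and C :: "'a monoid" +
  assumes same_carrier: "carrier C = carrier A"
    and brace_relation:
      "\<lbrakk>a \<in> carrier A; b \<in> carrier A; c \<in> carrier A\<rbrakk> \<Longrightarrow>
        a \<otimes>\<^bsub>C\<^esub> (b \<otimes>\<^bsub>A\<^esub> c) = (a \<otimes>\<^bsub>C\<^esub> b) \<otimes>\<^bsub>A\<^esub> inv\<^bsub>A\<^esub> a \<otimes>\<^bsub>A\<^esub> (a \<otimes>\<^bsub>C\<^esub> c)"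

definition Aut_sb :: "'a monoid \<Rightarrow> 'a monoid \<Rightarrow> ('a \<Rightarrow> 'a) monoid" where
  "Aut_sb A C = AutoGroup A \<lparr>carrier := auto A \<inter> auto C\<rparr>"

definition Hol :: "'a monoid \<Rightarrow> ('a \<times> ('a \<Rightarrow> 'a)) monoid" where
  "Hol N =
    \<lparr>carrier = carrier N \<times> auto N,
     Group.monoid.mult = (\<lambda>(\<eta>, \<alpha>) (\<mu>, \<beta>). (\<eta> \<otimes>\<^bsub>N\<^esub> \<alpha> \<mu>, \<alpha> \<otimes>\<^bsub>AutoGroup N\<^esub> \<beta>)),
     one = (\<one>\<^bsub>N\<^esub>, \<one>\<^bsub>AutoGroup N\<^esub>)\<rparr>"

definition hol_act :: "'a monoid \<Rightarrow> 'a \<times> ('a \<Rightarrow> 'a) \<Rightarrow> 'a \<Rightarrow> 'a" where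
  "hol_act N g \<mu> = fst g \<otimes>\<^bsub>N\<^esub> snd g \<mu>"

definition regular_subgroup :: "('a \<times> ('a \<Rightarrow> 'a)) set \<Rightarrow> 'a monoid \<Rightarrow> bool" where
  "regular_subgroup G N \<longleftrightarrow>
    subgroup G (Hol N) \<and>
    (\<forall>\<eta>\<in>carrier N. \<forall>\<mu>\<in>carrier N. \<exists>!g. g \<in> G \<and> hol_act N g \<eta> = \<mu>)"

text \<open>The element \<open>g\<^sub>\<eta>\<close> of \<open>G\<close> with first component \<open>\<eta>\<close>; it exists and is unique
  when \<open>G\<close> is regular.\<close>

definition elem_over :: "('a \<times> ('a \<Rightarrow> 'a)) set \<Rightarrow> 'a \<Rightarrow> 'a \<times> ('a \<Rightarrow> 'a)" where
  "elem_over G \<eta> = (THE g. g \<in> G \<and> fst g = \<eta>)"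

definition circ_group :: "'a monoid \<Rightarrow> ('a \<times> ('a \<Rightarrow> 'a)) set \<Rightarrow> 'a monoid" where
  "circ_group N G =
    N \<lparr>Group.monoid.mult := (\<lambda>\<eta> \<eta>'. fst (elem_over G \<eta> \<otimes>\<^bsub>Hol N\<^esub> elem_over G \<eta>'))\<rparr>"

lemma circ_group_simps [simp]:
  "carrier (circ_group N G) = carrier N"
  "\<one>\<^bsub>circ_group N G\<^esub> = \<one>\<^bsub>N\<^esub>"
  by (simp_all add: circ_group_def)

lemma Hol_simps [simp]:
  "carrier (Hol N) = carrier N \<times> auto N"
  "\<one>\<^bsub>Hol N\<^esub> = (\<one>\<^bsub>N\<^esub>, \<one>\<^bsub>AutoGroup N\<^esub>)"
  "(\<eta>, \<alpha>) \<otimes>\<^bsub>Hol N\<^esub> (\<mu>, \<beta>) = (\<eta> \<otimes>\<^bsub>N\<^esub> \<alpha> \<mu>, \<alpha> \<otimes>\<^bsub>AutoGroup N\<^esub> \<beta>)"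
  by (simp_all add: Hol_def)

lemma AutoGroup_simps:
  "carrier (AutoGroup N) = auto N"
  "\<one>\<^bsub>AutoGroup N\<^esub> = (\<lambda>x\<in>carrier N. x)"
  "\<alpha> \<in> auto N \<Longrightarrow> \<beta> \<in> auto N \<Longrightarrow> \<alpha> \<otimes>\<^bsub>AutoGroup N\<^esub> \<beta> = compose (carrier N) \<alpha> \<beta>"
  by (simp_all add: AutoGroup_def BijGroup_def auto_def)

lemma auto_closed: "\<alpha> \<in> auto N \<Longrightarrow> x \<in> carrier N \<Longrightarrow> \<alpha> x \<in> carrier N"
  by (auto simp: auto_def hom_def)

lemma auto_mult:
  "\<alpha> \<in> auto N \<Longrightarrow> x \<in> carrier N \<Longrightarrow> y \<in> carrier N \<Longrightarrow> \<alpha> (x \<otimes>\<^bsub>N\<^esub> y) = \<alpha> x \<otimes>\<^bsub>N\<^esub> \<alpha> y"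
  by (auto simp: auto_def hom_def)

lemma (in group) auto_one: "\<alpha> \<in> auto G \<Longrightarrow> \<alpha> \<one> = \<one>"
  using hom_one[of \<alpha> G] is_group by (auto simp: auto_def)

lemma group_Hol:
  assumes "group N"
  shows "group (Hol N)"
proof -
  interpret N: group N by fact
  interpret Aut: group "AutoGroup N" by (rule N.AutoGroup)
  note [simp] = auto_closed auto_mult N.auto_one
  have carr: "carrier (AutoGroup N) = auto N" by (rule AutoGroup_simps)
  have ap: "(\<alpha> \<otimes>\<^bsub>AutoGroup N\<^esub> \<beta>) x = \<alpha> (\<beta> x)"
    if "\<alpha> \<in> auto N" "\<beta> \<in> auto N" "x \<in> carrier N" for \<alpha> \<beta> x
    using that by (simp add: AutoGroup_simps compose_def)
  have ap1: "\<one>\<^bsub>AutoGroup N\<^esub> x = x" if "x \<in> carrier N" for x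
    using that by (simp add: AutoGroup_simps)
  note cl = Aut.m_closed[unfolded carr] Aut.one_closed[unfolded carr]
    Aut.inv_closed[unfolded carr] Aut.m_assoc[unfolded carr] Aut.l_one[unfolded carr]
    Aut.l_inv[unfolded carr]
  show ?thesis
  proof (rule groupI)
    show "x \<otimes>\<^bsub>Hol N\<^esub> y \<in> carrier (Hol N)"
      if "x \<in> carrier (Hol N)" "y \<in> carrier (Hol N)" for x y
      using that by (cases x; cases y) (simp add: cl)
    show "\<one>\<^bsub>Hol N\<^esub> \<in> carrier (Hol N)" by (simp add: cl)
    show "x \<otimes>\<^bsub>Hol N\<^esub> y \<otimes>\<^bsub>Hol N\<^esub> z = x \<otimes>\<^bsub>Hol N\<^esub> (y \<otimes>\<^bsub>Hol N\<^esub> z)"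
      if "x \<in> carrier (Hol N)" "y \<in> carrier (Hol N)" "z \<in> carrier (Hol N)" for x y z
      using that by (cases x; cases y; cases z) (simp add: cl ap N.m_assoc)
    show "\<one>\<^bsub>Hol N\<^esub> \<otimes>\<^bsub>Hol N\<^esub> x = x" if "x \<in> carrier (Hol N)" for x
      using that by (cases x) (simp add: cl ap1)
    show "\<exists>y\<in>carrier (Hol N). y \<otimes>\<^bsub>Hol N\<^esub> x = \<one>\<^bsub>Hol N\<^esub>" if "x \<in> carrier (Hol N)" for x
    proof -
      obtain \<eta> \<alpha> where x: "x = (\<eta>, \<alpha>)" by (cases x)
      let ?\<beta> = "inv\<^bsub>AutoGroup N\<^esub> \<alpha>"
      have "(?\<beta> (inv\<^bsub>N\<^esub> \<eta>), ?\<beta>) \<otimes>\<^bsub>Hol N\<^esub> x = \<one>\<^bsub>Hol N\<^esub>"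
        using that by (simp add: x cl auto_mult[symmetric])
      moreover have "(?\<beta> (inv\<^bsub>N\<^esub> \<eta>), ?\<beta>) \<in> carrier (Hol N)"
        using that by (simp add: x cl)
      ultimately show ?thesis by blast
    qed
  qed
qed

theorem skew_brace_of_regular_subgroup:
  assumes "group N" and reg: "regular_subgroup G N"
  shows "skew_brace N (circ_group N G)"
proof -
  interpret N: group N by fact
  interpret H: group "Hol N" using \<open>group N\<close> by (rule group_Hol)
  note [simp] = auto_closed auto_mult N.auto_one
  have sub: "subgroup G (Hol N)"
    using reg by (simp add: regular_subgroup_def)
  interpret G: group "Hol N \<lparr>carrier := G\<rparr>"
    using sub by (rule H.subgroup_imp_group)
  have GH: "g \<in> carrier N \<times> auto N" if "g \<in> G" for g
    using subgroup.subset[OF sub] that by auto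
  have ex1: "\<exists>!g. g \<in> G \<and> fst g = \<eta>" if "\<eta> \<in> carrier N" for \<eta>
  proof -
    have "\<exists>!g. g \<in> G \<and> hol_act N g \<one>\<^bsub>N\<^esub> = \<eta>"
      using reg that by (simp add: regular_subgroup_def)
    moreover have "hol_act N g \<one>\<^bsub>N\<^esub> = fst g" if "g \<in> G" for g
      using GH[OF that] by (auto simp: hol_act_def)
    ultimately show ?thesis by metis
  qed
  let ?g = "elem_over G"
  have gG: "?g \<eta> \<in> G" and gf: "fst (?g \<eta>) = \<eta>" if "\<eta> \<in> carrier N" for \<eta>
    using theI'[OF ex1[OF that]] by (simp_all add: elem_over_def)
  have gun: "?g (fst g) = g" if "g \<in> G" for g
  proof -
    have "fst g \<in> carrier N" using GH[OF that] by (simp add: mem_Times_iff)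
    from ex1[OF this] gG[OF this] gf[OF this] that show ?thesis by blast
  qed
  define \<gamma> where "\<gamma> \<eta> = snd (?g \<eta>)" for \<eta>
  have gp: "?g \<eta> = (\<eta>, \<gamma> \<eta>)" if "\<eta> \<in> carrier N" for \<eta>
    using gf[OF that] by (simp add: \<gamma>_def prod_eq_iff)
  have \<gamma>a: "\<gamma> \<eta> \<in> auto N" if "\<eta> \<in> carrier N" for \<eta>
    using GH[OF gG[OF that]] by (auto simp: gp[OF that])
  have circ: "a \<otimes>\<^bsub>circ_group N G\<^esub> b = a \<otimes>\<^bsub>N\<^esub> \<gamma> a b"
    if "a \<in> carrier N" "b \<in> carrier N" for a b
    using that by (simp add: circ_group_def gp)
  have gm: "?g (a \<otimes>\<^bsub>circ_group N G\<^esub> b) = ?g a \<otimes>\<^bsub>Hol N\<^esub> ?g b"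
    if "a \<in> carrier N" "b \<in> carrier N" for a b
  proof -
    have "?g a \<otimes>\<^bsub>Hol N\<^esub> ?g b \<in> G"
      using that by (intro subgroup.m_closed[OF sub] gG)
    from gun[OF this] show ?thesis by (simp add: circ_group_def)
  qed
  have cclosed: "a \<otimes>\<^bsub>circ_group N G\<^esub> b \<in> carrier N"
    if "a \<in> carrier N" "b \<in> carrier N" for a b
    using that \<gamma>a by (simp add: circ)
  have g1: "?g \<one>\<^bsub>N\<^esub> = \<one>\<^bsub>Hol N\<^esub>"
    using gun[OF subgroup.one_closed[OF sub]] by simp
  have ginj: "a = b" if "?g a = ?g b" "a \<in> carrier N" "b \<in> carrier N" for a b
    using that by (simp add: gp)
  have "group (circ_group N G)"
  proof (rule groupI, simp_all only: circ_group_simps)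
    show "\<one>\<^bsub>N\<^esub> \<in> carrier N" by simp
    show "x \<otimes>\<^bsub>circ_group N G\<^esub> y \<in> carrier N"
      if "x \<in> carrier N" "y \<in> carrier N" for x y
      using that by (rule cclosed)
    have gH: "?g x \<in> carrier (Hol N)" if "x \<in> carrier N" for x
      using GH[OF gG[OF that]] by simp
    show "x \<otimes>\<^bsub>circ_group N G\<^esub> y \<otimes>\<^bsub>circ_group N G\<^esub> z
        = x \<otimes>\<^bsub>circ_group N G\<^esub> (y \<otimes>\<^bsub>circ_group N G\<^esub> z)"
      if "x \<in> carrier N" "y \<in> carrier N" "z \<in> carrier N" for x y z
      by (rule ginj) (use that in \<open>simp_all only: gm cclosed H.m_assoc gH\<close>)
    show "\<one>\<^bsub>N\<^esub> \<otimes>\<^bsub>circ_group N G\<^esub> x = x" if "x \<in> carrier N" for x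
      by (rule ginj) (use that in \<open>simp_all only: gm g1 cclosed H.l_one gH N.one_closed\<close>)
    show "\<exists>y\<in>carrier N. y \<otimes>\<^bsub>circ_group N G\<^esub> x = \<one>\<^bsub>N\<^esub>" if x: "x \<in> carrier N" for x
    proof
      let ?h = "inv\<^bsub>Hol N\<^esub> ?g x"
      have h: "?h \<in> G" using subgroup.m_inv_closed[OF sub gG[OF x]] .
      show y: "fst ?h \<in> carrier N" using GH[OF h] by auto
      show "fst ?h \<otimes>\<^bsub>circ_group N G\<^esub> x = \<one>\<^bsub>N\<^esub>"
        by (rule ginj) (use x y in \<open>simp_all only: gm gun[OF h] g1 cclosed H.l_inv gH N.one_closed\<close>)
    qed
  qed
  then show ?thesis
  proof (intro skew_brace.intro skew_brace_axioms.intro)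
    show "a \<otimes>\<^bsub>circ_group N G\<^esub> (b \<otimes>\<^bsub>N\<^esub> c) =
        a \<otimes>\<^bsub>circ_group N G\<^esub> b \<otimes>\<^bsub>N\<^esub> inv\<^bsub>N\<^esub> a \<otimes>\<^bsub>N\<^esub> (a \<otimes>\<^bsub>circ_group N G\<^esub> c)"
      if "a \<in> carrier N" "b \<in> carrier N" "c \<in> carrier N" for a b c
      using that \<gamma>a[OF that(1)] by (simp add: circ N.m_assoc N.inv_solve_left)
  qed (simp_all add: \<open>group N\<close>)
qed

definition GL :: "nat \<Rightarrow> 'a::field mat monoid" where
  "GL n = units_of (ring_mat TYPE('a) n ())"

text \<open>\<open>blk A v\<close> is the block matrix with rows \<open>(A v)\<close> and \<open>(0 1)\<close>, where \<open>v\<close> is read as a column.\<close>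

definition blk :: "'a::field mat \<Rightarrow> 'a vec \<Rightarrow> 'a mat" where
  "blk A v = four_block_mat A (mat_of_cols (dim_vec v) [v]) (0\<^sub>m 1 (dim_col A)) (1\<^sub>m 1)"

definition N_group :: "nat \<Rightarrow> nat \<Rightarrow> 'a::field mat \<Rightarrow> 'a mat monoid" where
  "N_group p q M =
    GL (p + 1) \<lparr>carrier := {blk (M [^]\<^bsub>GL p\<^esub> k) v | k v. k < q \<and> v \<in> carrier_vec p}\<rparr>"

text \<open>Conjugation by \<open>S \<in> GL (p + 1)\<close>, as a map on \<open>N\<close> (extensional, as in \<^const>\<open>auto\<close>).\<close>

definition conj_N :: "nat \<Rightarrow> nat \<Rightarrow> 'a::field mat \<Rightarrow> 'a mat \<Rightarrow> 'a mat \<Rightarrow> 'a mat" where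
  "conj_N p q M S =
    (\<lambda>R\<in>carrier (N_group p q M). S \<otimes>\<^bsub>GL (p + 1)\<^esub> R \<otimes>\<^bsub>GL (p + 1)\<^esub> inv\<^bsub>GL (p + 1)\<^esub> S)"

text \<open>Vectors and matrices are indexed from 0, so the basis vector \<open>e\<^sub>i\<close> of the mathematical
  notation is \<open>unit_vec p (i - 1)\<close>. The matrix \<open>J\<close> is \<open>jordan_block p 1\<close>.\<close>

definition X_elem :: "nat \<Rightarrow> nat \<Rightarrow> 'a::field mat \<Rightarrow> 'a mat \<times> ('a mat \<Rightarrow> 'a mat)" where
  "X_elem p q M = (blk M (0\<^sub>v p), conj_N p q M (blk (1\<^sub>m p) (0\<^sub>v p)))"

definition Y_elem ::
    "nat \<Rightarrow> nat \<Rightarrow> 'a::field mat \<Rightarrow> 'a vec \<Rightarrow> 'a mat \<times> ('a mat \<Rightarrow> 'a mat)" where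
  "Y_elem p q M v = (blk (1\<^sub>m p) v, conj_N p q M (blk (1\<^sub>m p) (- v)))"

definition Z_elem :: "nat \<Rightarrow> nat \<Rightarrow> 'a::field mat \<Rightarrow> 'a mat \<times> ('a mat \<Rightarrow> 'a mat)" where
  "Z_elem p q M =
    (blk (1\<^sub>m p) (unit_vec p (p - 1)),
     conj_N p q M (blk (jordan_block p 1) (- unit_vec p (p - 1))))"

definition G_subgroup :: "nat \<Rightarrow> nat \<Rightarrow> 'a::field mat \<Rightarrow> ('a mat \<times> ('a mat \<Rightarrow> 'a mat)) set" where
  "G_subgroup p q M =
    generate (Hol (N_group p q M))
      {X_elem p q M, Y_elem p q M (unit_vec p (p - 2)), Z_elem p q M}"

text \<open>The circle group of the skew brace \<open>B\<close>; its dot group is \<open>N_group p q M\<close>.\<close>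

definition B_circ :: "nat \<Rightarrow> nat \<Rightarrow> 'a::field mat \<Rightarrow> 'a mat monoid" where
  "B_circ p q M = circ_group (N_group p q M) (G_subgroup p q M)"

end

(*
  Write el a v for blk (M^a) (M^a v).  In these coordinates N has the product
  (a, v) (b, w) = (a + b, M^(-b) v + w), and G turns out to consist of the elements g_(a, v)
  acting on N by R |-> M^a J^c R S^(-1) with S = blk (J^c) (-v), where c is the last coordinate of v;
  hence (a, v) o (b, w) = (a + p^c b, v + J^c w).

  An automorphism of both structures fixes V = {(0, v)}, the Sylow p-subgroup of (B, .), and
  {(a, 0)}, the Sylow q-subgroup of (B, o), so it has the form (a, v) |-> (k a, f v) with f additive
  and f M = M^k f.  Since p has order p modulo q, compatibility with o says that f preserves the
  last coordinate and commutes with J.  Such an f is unipotent with (f - 1)^p = 0, so f^p = 1, hence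
  k^p = 1 modulo q and k = p^j for some j.  The set where f agrees with J^j is invariant under M and
  contains e_1; as M acts irreducibly on V, f = J^j.
*)
theory Submission
  imports Defs "Berlekamp_Zassenhaus.Berlekamp_Type_Based" "HOL-Number_Theory.Number_Theory"
begin

section \<open>Congruences and counting modulo \<open>q\<close>\<close>

text \<open>The divisibility hypothesis enters only through the fact that \<open>p\<close> has order
  exactly \<open>p\<close> modulo \<open>q\<close>. Its main uses are these: \<open>p ^ c\<close>
  modulo \<open>q\<close> determines \<open>c\<close> modulo \<open>p\<close>, so the circle
  operation remembers the last coordinate; the powers of \<open>p\<close> exhaust the solutions of
  x^p = 1 modulo \<open>q\<close>; and \<open>M\<close> acts irreducibly. The last is a count: the
  nonzero vectors of an \<open>M\<close>-invariant subgroup with p^d elements fall into orbits of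
  length \<open>q\<close>, so \<open>q\<close> divides p^d - 1 and \<open>p\<close> divides d.

  The map f comes from group homomorphisms and is treated as an additive map throughout, so
  subgroups of V and Lagrange's theorem take the place of subspaces and dimensions. The two Sylow
  subgroups are not found by Sylow theory: p-th powers for the dot operation and q-th powers for the
  circle operation locate the images of their elements.\<close>

lemma cong_power_one_iff_dvd:
  fixes p q :: nat
  assumes p: "Factorial_Ring.prime p" and q: "Factorial_Ring.prime q" and dvd: "q dvd (p ^ p - 1) div (p - 1)"
  shows "[p ^ i = 1] (mod q) \<longleftrightarrow> p dvd i"
proof -
  have p1: "p > 1" using p prime_gt_1_nat by blast
  have geo: "p ^ p - 1 = (p - 1) * (\<Sum>i<p. p ^ i)"
  proof -
    have "int (p ^ p - 1) = int ((p - 1) * (\<Sum>i<p. p ^ i))"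
      using power_diff_1_eq[of "int p" p] p1 by (simp add: of_nat_diff)
    then show ?thesis by (simp only: of_nat_eq_iff)
  qed
  then have qs: "q dvd (\<Sum>i<p. p ^ i)" using dvd p1 by simp
  then have "q dvd p ^ p - 1" using geo by simp
  then have pp: "[p ^ p = 1] (mod q)"
    using p1 cong_altdef_nat[of 1 "p ^ p" q] by simp
  \<comment> \<open>If \<open>p\<close> were 1 modulo \<open>q\<close>, the geometric sum would be
    congruent to \<open>p\<close>; then \<open>q\<close> would divide \<open>p\<close>, hence
    1.\<close>
  have n1: "\<not> [p = 1] (mod q)"
  proof
    assume *: "[p = 1] (mod q)"
    then have "[(\<Sum>i<p. p ^ i) = (\<Sum>i<p. 1 ^ i)] (mod q)" by (intro cong_sum cong_pow)
    then have "q dvd p" using qs by (simp add: cong_dvd_iff)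
    then have "q dvd 1" using * by (simp add: cong_dvd_iff)
    then show False using q by simp
  qed
  have "Pocklington.ord q p dvd p" using pp ord_divides[of p p q] by blast
  moreover have "Pocklington.ord q p \<noteq> 1"
    using n1 ord_works[of p q] by (metis power_one_right)
  ultimately have "Pocklington.ord q p = p" using p prime_nat_iff by blast
  then show ?thesis using ord_divides[of p i q] by simp
qed

text \<open>The residues of \<open>p ^ j\<close> for \<open>j < p\<close> are \<open>p\<close>
  distinct roots of x^p = 1, and modulo a prime there are at most \<open>p\<close> roots, so every
  root is among them.\<close>

lemma pth_root_cong_power:
  fixes p q k :: nat
  assumes p: "Factorial_Ring.prime p" and q: "Factorial_Ring.prime q" and dvd: "q dvd (p ^ p - 1) div (p - 1)"
    and k: "[k ^ p = 1] (mod q)"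
  obtains j where "j < p" "[k = p ^ j] (mod q)"
proof -
  note iff = cong_power_one_iff_dvd[OF p q dvd]
  have p0: "p > 0" using p prime_gt_0_nat by blast
  have pp: "[p ^ p = 1] (mod q)" using iff by simp
  have cop: "algebraic_semidom_class.coprime p q"
    using cong_imp_coprime[OF cong_sym[OF pp]] p0 by simp
  let ?R = "{x \<in> {..<q}. [x ^ p = 1] (mod q)}"
  let ?f = "\<lambda>j. p ^ j mod q"
  have inj: "inj_on ?f {..<p}"
  proof (rule linorder_inj_onI)
    fix i j assume ij: "i < j" "i \<in> {..<p}" "j \<in> {..<p}"
    show "?f i \<noteq> ?f j"
    proof
      assume "?f i = ?f j"
      then have "[p ^ i * 1 = p ^ i * p ^ (j - i)] (mod q)"
        using ij by (simp add: cong_def flip: power_add)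
      then have "[p ^ (j - i) = 1] (mod q)"
        using cong_mult_lcancel_nat[of "p ^ i" q 1 "p ^ (j - i)"] cop by (simp add: cong_sym_eq)
      then show False using ij iff by (auto dest: dvd_imp_le)
    qed
  qed auto
  have sub: "?f ` {..<p} \<subseteq> ?R"
  proof
    fix x assume "x \<in> ?f ` {..<p}"
    then obtain j where j: "x = p ^ j mod q" by auto
    have "[(p ^ j) ^ p = 1] (mod q)"
      using cong_pow[OF pp, of j] by (simp flip: power_mult add: mult.commute[of j])
    then show "x \<in> ?R" using j q by (auto simp: cong_def power_mod prime_gt_0_nat)
  qed
  have "card ?R \<le> p" using roots_mod_prime_bound[OF q p0] by simp
  moreover have "card (?f ` {..<p}) = p" using inj by (simp add: card_image)
  ultimately have "?f ` {..<p} = ?R" using sub by (intro card_seteq) auto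
  moreover have "k mod q \<in> ?R" using k q by (auto simp: cong_def power_mod prime_gt_0_nat)
  ultimately obtain j where "j < p" "k mod q = p ^ j mod q" by auto
  then show ?thesis using that by (auto simp: cong_def)
qed

text \<open>The iterates of \<open>T\<close> act on \<open>S\<close> as a cyclic group of prime
  order \<open>q\<close>, so the moved points are a union of orbits with exactly \<open>q\<close>
  elements. In the application \<open>T\<close> is multiplication by \<open>M\<close>.\<close>

lemma prime_dvd_card_nonfixed:
  assumes S: "finite S" and q: "Factorial_Ring.prime (q :: nat)" and T: "\<And>x. x \<in> S \<Longrightarrow> T x \<in> S"
    and per: "\<And>x. x \<in> S \<Longrightarrow> (T ^^ q) x = x"
  shows "q dvd card {x \<in> S. T x \<noteq> x}"
proof -
  let ?A = "{x \<in> S. T x \<noteq> x}"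
  have q0: "q > 0" using q prime_gt_0_nat by blast
  have TS: "(T ^^ i) x \<in> S" if "x \<in> S" for i x using that T by (induct i) auto
  have md: "(T ^^ i) x = (T ^^ (i mod q)) x" if "x \<in> S" for i x
    using funpow_mod_eq[OF per[OF that], of i] by simp
  \<comment> \<open>The extra \<open>q - i mod q\<close> steps complete a period, so iterates of
    \<open>T\<close> are invertible on \<open>S\<close> by further iterates.\<close>
  have unwind: "(T ^^ (q - i mod q)) ((T ^^ i) x) = x" if "x \<in> S" for i x
  proof -
    have "(T ^^ (q - i mod q)) ((T ^^ i) x) = (T ^^ (q - i mod q + i mod q)) x"
      using md[OF that, of i] by (simp add: funpow_add)
    then show ?thesis using per[OF that] q0 by (simp add: less_imp_le)
  qed
  have TA: "(T ^^ i) x \<in> ?A" if "x \<in> ?A" for i x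
  proof -
    have x: "x \<in> S" "T x \<noteq> x" using that by auto
    have "T ((T ^^ i) x) = (T ^^ i) (T x)" by (simp add: funpow_swap1)
    then have "T ((T ^^ i) x) \<noteq> (T ^^ i) x"
      using unwind[OF x(1), of i] unwind[OF T[OF x(1)], of i] x(2) by metis
    then show ?thesis using TS x by auto
  qed
  let ?r = "{(x, y). x \<in> ?A \<and> (\<exists>i. y = (T ^^ i) x)}"
  have "equiv ?A ?r"
  proof (rule equivI)
    show "?r \<subseteq> ?A \<times> ?A" using TA by blast
    show "refl_on ?A ?r" by (auto simp: refl_on_def intro: exI[of _ 0])
    show "sym ?r"
    proof (rule symI)
      fix x y assume "(x, y) \<in> ?r"
      then obtain i where x: "x \<in> ?A" and y: "y = (T ^^ i) x" by blast
      have "y \<in> ?A" unfolding y using TA[OF x] .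
      moreover have "x = (T ^^ (q - i mod q)) y" unfolding y using unwind x by simp
      ultimately show "(y, x) \<in> ?r" by blast
    qed
    show "trans ?r"
    proof (rule transI)
      fix x y z assume "(x, y) \<in> ?r" "(y, z) \<in> ?r"
      then obtain i j where x: "x \<in> ?A" and z: "z = (T ^^ j) ((T ^^ i) x)" by blast
      have "z = (T ^^ (j + i)) x" unfolding z by (simp add: funpow_add)
      then show "(x, z) \<in> ?r" using x by blast
    qed
  qed
  moreover have "q dvd card C" if C: "C\<in>Equiv_Relations.quotient ?A ?r" for C
  proof -
    obtain x where x: "x \<in> ?A" "C = ?r `` {x}" using C by (auto elim: quotientE)
    have "C = (\<lambda>i. (T ^^ i) x) ` {..<q}"
    proof -
      have "C = range (\<lambda>i. (T ^^ i) x)" using x unfolding Image_def by blast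
      moreover have "(T ^^ i) x \<in> (\<lambda>i. (T ^^ i) x) ` {..<q}" for i
        using md[of x i] x q0 by auto
      ultimately show ?thesis by auto
    qed
    moreover have "inj_on (\<lambda>i. (T ^^ i) x) {..<q}"
    proof (rule linorder_inj_onI)
      fix i j assume ij: "i < j" "i \<in> {..<q}" "j \<in> {..<q}"
      show "(T ^^ i) x \<noteq> (T ^^ j) x"
      proof
        assume eq: "(T ^^ i) x = (T ^^ j) x"
        let ?d = "j - i"
        have "(T ^^ j) x = (T ^^ i) ((T ^^ ?d) x)"
          using ij funpow_add[of i ?d T] by simp
        then have "(T ^^ (q - i mod q)) ((T ^^ i) ((T ^^ ?d) x)) = (T ^^ (q - i mod q)) ((T ^^ i) x)"
          using eq by simp
        then have d: "(T ^^ ?d) x = x" using unwind TS x by simp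
        have dm: "(T ^^ (?d * m)) x = x" for m
          by (induct m) (simp_all add: d funpow_add)
        have "\<not> q dvd ?d" using ij by (auto dest: dvd_imp_le)
        then have "algebraic_semidom_class.coprime ?d q" 
          using prime_imp_coprime[OF q, of ?d] algebraic_semidom_class.coprime_commute[of q ?d] by simp
        \<comment> \<open>A multiple of \<open>?d\<close> that is 1 modulo \<open>q\<close>:
          iterating \<open>T\<close> that often fixes \<open>x\<close>, but is also the same as
          applying \<open>T\<close> once.\<close>
        then obtain m where m: "[?d * m = 1] (mod q)" using cong_solve_coprime_nat by auto
        have "(T ^^ (?d * m)) x = (T ^^ 1) x"
          using md[of x "?d * m"] md[of x 1] m x by (simp add: cong_def)
        then show False using dm x by simp
      qed
    qed auto
    ultimately show ?thesis by (simp add: card_image)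
  qed
  ultimately show ?thesis by (intro equiv_imp_dvd_card[of ?A ?r]) (use S in auto)
qed

text \<open>The recurrence is that of \<open>x n i = f\<^sup>n ((f - 1)\<^sup>i v)\<close>; it replaces the binomial theorem
  for \<open>f = 1 + (f - 1)\<close>, where \<open>f\<close> is only an additive map.\<close>

lemma pascal_recurrence_sum:
  fixes x :: "nat \<Rightarrow> nat \<Rightarrow> 'a :: comm_semiring_1"
  assumes "\<And>n i. x (Suc n) i = x n i + x n (Suc i)"
  shows "x n i = (\<Sum>m\<le>n. of_nat (n choose m) * x 0 (i + m))"
proof (induct n arbitrary: i)
  case (Suc n)
  let ?a = "\<lambda>m. x 0 (i + m)"
  have *: "(\<Sum>m\<le>n. of_nat (n choose m) * ?a m) = ?a 0 + (\<Sum>m\<le>n. of_nat (n choose Suc m) * ?a (Suc m))"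
    using sum.atMost_Suc_shift[of "\<lambda>m. of_nat (n choose m) * ?a m" n] by (simp del: add_Suc_right add: binomial_eq_0)
  have "(\<Sum>m\<le>Suc n. of_nat (Suc n choose m) * ?a m)
      = (\<Sum>m\<le>n. of_nat (n choose m) * ?a (Suc m)) + (?a 0 + (\<Sum>m\<le>n. of_nat (n choose Suc m) * ?a (Suc m)))"
    by (subst sum.atMost_Suc_shift) (simp add: distrib_right sum.distrib add_ac del: sum.atMost_Suc)
  then show ?case unfolding assms Suc * by (simp add: add.commute)
qed simp

text \<open>The middle binomial coefficients are multiples of \<open>p\<close> and vanish in the
  field. For the intended sequence this reads f^p v = v + (f - 1)^p v.\<close>

lemma pascal_recurrence_prime_char:
  fixes x :: "nat \<Rightarrow> nat \<Rightarrow> 'p :: prime_card mod_ring"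
  assumes "\<And>n i. x (Suc n) i = x n i + x n (Suc i)"
    and p: "Factorial_Ring.prime p" "CARD('p) = p"
  shows "x p 0 = x 0 0 + x 0 p"
proof -
  have p0: "0 < p" using p prime_gt_0_nat by blast
  have *: "of_nat (p choose m) * x 0 m = 0" if "m \<in> {..p} - {0, p}" for m
  proof -
    have "p dvd p choose m" using that p by (intro dvd_choose_prime) auto
    then have "(of_nat (p choose m) :: 'p mod_ring) = 0"
      using of_nat_card_eq_0[where 'a='p] unfolding p(2) by (auto simp: dvd_def)
    then show ?thesis by simp
  qed
  have "x p 0 = (\<Sum>m\<le>p. of_nat (p choose m) * x 0 m)"
    using pascal_recurrence_sum[of x p 0] assms(1) by simp
  also have "\<dots> = (\<Sum>m\<in>{0,p}. of_nat (p choose m) * x 0 m)"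
    using * by (intro sum.mono_neutral_right) auto
  finally show ?thesis using p0 by simp
qed

section \<open>Additive maps commuting with a Jordan block\<close>

text \<open>\<open>shift_vec m\<close> is multiplication by the nilpotent matrix (J - 1)^m, with J
  the Jordan block for the eigenvalue 1.\<close>

definition shift_vec :: "nat \<Rightarrow> 'a :: zero vec \<Rightarrow> 'a vec" where
  "shift_vec m v = vec (dim_vec v) (\<lambda>i. if i + m < dim_vec v then v $ (i + m) else 0)"

lemma shift_vec_carrier [simp]: "v \<in> carrier_vec n \<Longrightarrow> shift_vec m v \<in> carrier_vec n"
  by (intro carrier_vecI) (simp add: shift_vec_def)

lemma dim_shift_vec [simp]: "dim_vec (shift_vec m v) = dim_vec v"
  by (simp add: shift_vec_def)

lemma index_shift_vec:
  "v \<in> carrier_vec n \<Longrightarrow> i < n \<Longrightarrow> shift_vec m v $ i = (if i + m < n then v $ (i + m) else 0)"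
  by (auto simp: shift_vec_def)

lemma shift_vec_0: "shift_vec 0 v = v"
  by (auto simp: shift_vec_def)

lemma shift_vec_Suc: "shift_vec (Suc m) v = shift_vec 1 (shift_vec m v)"
  by (auto simp: shift_vec_def)

lemma jordan_block_carrier: "jordan_block n a \<in> carrier_mat n n"
  by simp

lemma jordan_block_1_mult_vec:
  fixes v :: "'a :: comm_ring_1 vec"
  assumes v: "v \<in> carrier_vec n"
  shows "jordan_block n 1 *\<^sub>v v = v + shift_vec 1 v"
proof (rule eq_vecI)
  fix i assume "i < dim_vec (v + shift_vec 1 v)"
  then have i: "i < n" using v by (simp add: shift_vec_def)
  have "(jordan_block n 1 *\<^sub>v v) $ i = (\<Sum>j\<in>{0..<n}. (if j = i then v $ j else 0) + (if j = Suc i then v $ j else 0))"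
  proof -
    have "(jordan_block n 1 *\<^sub>v v) $ i = (\<Sum>j\<in>{0..<n}. jordan_block n 1 $$ (i, j) * v $ j)"
      using i v by (simp add: scalar_prod_def)
    also have "\<dots> = (\<Sum>j\<in>{0..<n}. (if j = i then v $ j else 0) + (if j = Suc i then v $ j else 0))"
      using i by (intro sum.cong) (auto simp: jordan_block_def)
    finally show ?thesis .
  qed
  also have "\<dots> = v $ i + shift_vec 1 v $ i"
    using i v by (auto simp: sum.distrib index_shift_vec)
  also have "\<dots> = (v + shift_vec 1 v) $ i"
    using i v by simp
  finally show "(jordan_block n 1 *\<^sub>v v) $ i = (v + shift_vec 1 v) $ i" .
qed (use v in \<open>auto simp: shift_vec_def\<close>)

lemma vec_cong_addI:
  fixes u v w :: "'a :: ab_group_add vec"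
  assumes "u + v = u + w" "u \<in> carrier_vec n" "v \<in> carrier_vec n" "w \<in> carrier_vec n"
  shows "v = w"
proof (rule eq_vecI)
  fix i assume i: "i < dim_vec w"
  have "(u + v) $ i = (u + w) $ i" by (simp only: assms(1))
  then show "v $ i = w $ i" using assms(2-) i by simp
qed (use assms in auto)

text \<open>Two maps are meant: the one that a skew brace automorphism induces on vectors, and
  multiplication by the Jordan block itself.\<close>

locale jordan_commuting =
  fixes n :: nat and f :: "'a :: comm_ring_1 vec \<Rightarrow> 'a vec"
  assumes closed [simp]: "v \<in> carrier_vec n \<Longrightarrow> f v \<in> carrier_vec n"
    and add: "v \<in> carrier_vec n \<Longrightarrow> w \<in> carrier_vec n \<Longrightarrow> f (v + w) = f v + f w"
    and commute: "v \<in> carrier_vec n \<Longrightarrow> f (jordan_block n 1 *\<^sub>v v) = jordan_block n 1 *\<^sub>v f v"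
    and last_fixed: "v \<in> carrier_vec n \<Longrightarrow> f v $ (n - 1) = v $ (n - 1)"
begin

lemma map_zero: "f (0\<^sub>v n) = 0\<^sub>v n"
proof -
  have "f (0\<^sub>v n) + f (0\<^sub>v n) = f (0\<^sub>v n) + 0\<^sub>v n" using add[of "0\<^sub>v n" "0\<^sub>v n"] by simp
  then show ?thesis by (rule vec_cong_addI[where n = n]) auto
qed

text \<open>Since J u is \<open>u + shift_vec 1 u\<close>, cancelling \<open>f u\<close> turns
  commuting with J into commuting with its nilpotent part.\<close>

lemma map_shift: "v \<in> carrier_vec n \<Longrightarrow> f (shift_vec m v) = shift_vec m (f v)"
proof (induct m)
  case (Suc m)
  have "f u + f (shift_vec 1 u) = f u + shift_vec 1 (f u)" if "u \<in> carrier_vec n" for u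
    using commute[OF that] that by (simp add: jordan_block_1_mult_vec add)
  then have "f (shift_vec 1 u) = shift_vec 1 (f u)" if "u \<in> carrier_vec n" for u
    using that by (metis vec_cong_addI closed shift_vec_carrier)
  then show ?case using Suc by (simp add: shift_vec_Suc[of m])
qed (simp add: shift_vec_0)

text \<open>The shift by \<open>n - 1\<close> keeps only the last coordinate and moves it to index
  0. So the first basis vector is that shift of every vector with last coordinate 1, in particular
  of the last basis vector and of its image under \<open>f\<close>.\<close>

lemma map_first_unit_vec:
  assumes "n > 0"
  shows "f (unit_vec n 0) = unit_vec n 0"
proof -
  let ?e = "unit_vec n (n - 1) :: 'a vec"
  have s: "unit_vec n 0 = shift_vec (n - 1) u" if "u \<in> carrier_vec n" "u $ (n - 1) = 1" for u :: "'a vec"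
    using that assms by (intro eq_vecI) (auto simp: index_shift_vec shift_vec_def)
  have "f (unit_vec n 0) = shift_vec (n - 1) (f ?e)"
    using s[of ?e] assms by (simp add: map_shift)
  also have "\<dots> = unit_vec n 0"
    using assms last_fixed[of ?e] by (intro s[symmetric]) auto
  finally show ?thesis .
qed

lemma funpow_closed [simp]: "v \<in> carrier_vec n \<Longrightarrow> (f ^^ m) v \<in> carrier_vec n"
  by (induct m) auto

lemma funpow_add_vec:
  "v \<in> carrier_vec n \<Longrightarrow> w \<in> carrier_vec n \<Longrightarrow> (f ^^ m) (v + w) = (f ^^ m) v + (f ^^ m) w"
  by (induct m) (auto simp: add)

definition diff_map :: "'a vec \<Rightarrow> 'a vec" where
  "diff_map v = f v - v"

lemma diff_map_closed [simp]: "v \<in> carrier_vec n \<Longrightarrow> diff_map v \<in> carrier_vec n"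
  by (simp add: diff_map_def)

text \<open>The map f - 1 lengthens a tail of zeros by one. A vector ending in \<open>s\<close>
  zeros is the shift by \<open>s\<close> of some \<open>u\<close>; as \<open>f\<close> commutes with
  the shift, the new entry in the tail is the last coordinate of f u - u, which is 0.\<close>

lemma diff_map_support:
  assumes v: "v \<in> carrier_vec n" and supp: "\<And>i. i < n \<Longrightarrow> n \<le> i + s \<Longrightarrow> v $ i = 0"
    and i: "i < n" "n \<le> i + Suc s"
  shows "diff_map v $ i = 0"
proof -
  define u where "u = vec n (\<lambda>j. if s \<le> j then v $ (j - s) else 0)"
  have u: "u \<in> carrier_vec n" by (simp add: u_def)
  have "v = shift_vec s u"
    using v supp by (intro eq_vecI) (auto simp: u_def shift_vec_def)
  then have "diff_map v = shift_vec s (f u) - shift_vec s u"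
    using map_shift[OF u, of s] by (simp add: diff_map_def)
  then have "diff_map v $ i = shift_vec s (f u) $ i - shift_vec s u $ i"
    using u i by simp
  also have "\<dots> = (if i + s < n then f u $ (i + s) - u $ (i + s) else 0)"
    using i by (simp add: index_shift_vec[OF u] index_shift_vec[OF closed[OF u]])
  also have "\<dots> = 0"
  proof (cases "i + s < n")
    case True
    then have "i + s = n - 1" using i by simp
    then show ?thesis using last_fixed[OF u] by simp
  qed simp
  finally show ?thesis .
qed

lemma diff_map_nilpotent: "v \<in> carrier_vec n \<Longrightarrow> (diff_map ^^ n) v = 0\<^sub>v n"
proof -
  assume v: "v \<in> carrier_vec n"
  have c: "(diff_map ^^ s) v \<in> carrier_vec n" for s by (induct s) (auto simp: v)
  have "i < n \<longrightarrow> n \<le> i + s \<longrightarrow> (diff_map ^^ s) v $ i = 0" for i s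
  proof (induct s arbitrary: i)
    case (Suc s)
    show ?case using diff_map_support[OF c[of s], of s i] Suc by simp
  qed simp
  then show ?thesis using c[of n] by (intro eq_vecI) auto
qed

end

lemma jordan_commuting_funpow_prime:
  fixes f :: "'p :: prime_card mod_ring vec \<Rightarrow> 'p mod_ring vec"
  assumes "jordan_commuting p f" and p: "Factorial_Ring.prime p" "CARD('p) = p" and v: "v \<in> carrier_vec p"
  shows "(f ^^ p) v = v"
proof -
  interpret jordan_commuting p f by fact
  have c: "(diff_map ^^ s) v \<in> carrier_vec p" for s by (induct s) (auto simp: v)
  have fd: "f u = u + diff_map u" if "u \<in> carrier_vec p" for u
    using that closed[OF that] unfolding diff_map_def by (intro eq_vecI) auto
  have "(f ^^ p) v $ j = v $ j" if j: "j < p" for j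
  proof -
    \<comment> \<open>Fixing a coordinate \<open>j\<close> turns the recurrence between vectors into
      one between field elements, as the binomial lemma requires.\<close>
    let ?x = "\<lambda>m i. (f ^^ m) ((diff_map ^^ i) v) $ j"
    have "?x p 0 = ?x 0 0 + ?x 0 p"
    proof (rule pascal_recurrence_prime_char[OF _ p])
      fix m i
      have "(f ^^ Suc m) ((diff_map ^^ i) v) = (f ^^ m) (f ((diff_map ^^ i) v))"
        by (simp add: funpow_swap1)
      also have "\<dots> = (f ^^ m) ((diff_map ^^ i) v) + (f ^^ m) ((diff_map ^^ Suc i) v)"
        using c[of i] by (simp add: fd funpow_add_vec)
      finally have "?x (Suc m) i = ((f ^^ m) ((diff_map ^^ i) v) + (f ^^ m) ((diff_map ^^ Suc i) v)) $ j"
        by (rule arg_cong)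
      also have "\<dots> = ?x m i + ?x m (Suc i)"
        using j carrier_vecD[OF funpow_closed[OF c[of "Suc i"], of m]] by (intro index_add_vec(1)) metis
      finally show "?x (Suc m) i = ?x m i + ?x m (Suc i)" .
    qed
    then show ?thesis using diff_map_nilpotent[OF v] j by simp
  qed
  then show ?thesis using v funpow_closed[OF v, of p] by (intro eq_vecI) auto
qed

lemma index_jordan_block_1_mult_vec_last:
  fixes v :: "'a :: comm_ring_1 vec"
  assumes "v \<in> carrier_vec n" "n > 0"
  shows "(jordan_block n 1 *\<^sub>v v) $ (n - 1) = v $ (n - 1)"
  using assms by (simp add: jordan_block_1_mult_vec index_shift_vec)

text \<open>Through this instance the facts about \<open>f\<close> also yield J^p = 1 and J e_1 =
  e_1.\<close>

lemma jordan_commuting_jordan_block: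
  assumes "n > 0"
  shows "jordan_commuting n (\<lambda>v. jordan_block n (1 :: 'a :: comm_ring_1) *\<^sub>v v)"
proof
  fix v w :: "'a vec" assume v: "v \<in> carrier_vec n" and w: "w \<in> carrier_vec n"
  show "jordan_block n 1 *\<^sub>v v \<in> carrier_vec n"
    using v by (rule mult_mat_vec_carrier[OF jordan_block_carrier])
  show "jordan_block n 1 *\<^sub>v (v + w) = jordan_block n 1 *\<^sub>v v + jordan_block n 1 *\<^sub>v w"
    using v w by (rule mult_add_distrib_mat_vec[OF jordan_block_carrier])
  show "(jordan_block n 1 *\<^sub>v v) $ (n - 1) = v $ (n - 1)"
    using v assms by (rule index_jordan_block_1_mult_vec_last)
qed (rule refl)

section \<open>Matrices and their powers acting on vectors\<close>

lemma mult_mat_vec_unit: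
  fixes A :: "'a :: comm_ring_1 mat"
  assumes "A \<in> carrier_mat m n" "j < n"
  shows "A *\<^sub>v unit_vec n j = col A j"
  using assms by (intro eq_vecI) auto

lemma eq_mat_mult_vecI:
  fixes A B :: "'a :: comm_ring_1 mat"
  assumes "A \<in> carrier_mat m n" "B \<in> carrier_mat m n" "\<And>v. v \<in> carrier_vec n \<Longrightarrow> A *\<^sub>v v = B *\<^sub>v v"
  shows "A = B"
proof (rule mat_col_eqI)
  fix j assume "j < dim_col B"
  then have "j < n" using assms(2) by simp
  then show "col A j = col B j"
    using assms(3)[of "unit_vec n j"] assms(1,2) by (simp add: mult_mat_vec_unit)
qed (use assms(1,2) in auto)

lemma pow_mat_mult_vec:
  fixes A :: "'a :: comm_ring_1 mat"
  assumes "A \<in> carrier_mat n n" "v \<in> carrier_vec n"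
  shows "(A ^\<^sub>m k) *\<^sub>v v = (((*\<^sub>v) A) ^^ k) v"
  using assms(2)
proof (induct k arbitrary: v)
  case (Suc k)
  have "A ^\<^sub>m Suc k *\<^sub>v v = (A ^\<^sub>m k) *\<^sub>v (A *\<^sub>v v)"
    using assms(1) Suc.prems by (simp add: assoc_mult_mat_vec[of _ n n _ n] pow_carrier_mat)
  also have "\<dots> = (((*\<^sub>v) A) ^^ k) (A *\<^sub>v v)"
    using assms(1) Suc by (intro Suc.hyps) (rule mult_mat_vec_carrier)
  finally show ?case by (simp add: funpow_swap1)
qed (use assms in simp)

lemma jordan_block_pow_prime:
  assumes p: "Factorial_Ring.prime p" "CARD('p) = p"
  shows "jordan_block p (1 :: 'p :: prime_card mod_ring) ^\<^sub>m p = 1\<^sub>m p"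
proof (rule eq_mat_mult_vecI)
  fix v :: "'p mod_ring vec" assume v: "v \<in> carrier_vec p"
  show "jordan_block p 1 ^\<^sub>m p *\<^sub>v v = 1\<^sub>m p *\<^sub>v v"
    using v p jordan_commuting_funpow_prime[OF jordan_commuting_jordan_block p, of v]
    by (simp add: pow_mat_mult_vec[of _ p] prime_gt_0_nat)
qed (auto intro: pow_carrier_mat)

section \<open>Affine block matrices\<close>

lemma pow_mat_add:
  assumes "A \<in> carrier_mat n n"
  shows "A ^\<^sub>m (j + k) = A ^\<^sub>m j * A ^\<^sub>m k"
proof (induct k)
  case (Suc k)
  then show ?case using assms by (simp add: assoc_mult_mat[of _ n n _ n _ n] pow_carrier_mat)
qed (use assms in \<open>simp add: right_mult_one_mat[of _ n n] pow_carrier_mat\<close>)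

lemma blk_carrier: "A \<in> carrier_mat n n \<Longrightarrow> v \<in> carrier_vec n \<Longrightarrow> blk A v \<in> carrier_mat (n + 1) (n + 1)"
  by (auto simp: blk_def)

lemma blk_mult:
  assumes A: "A \<in> carrier_mat n n" and B: "B \<in> carrier_mat n n"
    and v: "v \<in> carrier_vec n" and w: "w \<in> carrier_vec n"
  shows "blk A v * blk B w = blk (A * B) (A *\<^sub>v w + v)"
proof -
  let ?c = "\<lambda>v. mat_of_cols n [v]"
  have AB: "A * B \<in> carrier_mat n n" using A B by simp
  have Aw: "A *\<^sub>v w \<in> carrier_vec n" using A w by simp
  have "blk A v * blk B w = four_block_mat (A * B + ?c v * 0\<^sub>m 1 n) (A * ?c w + ?c v * 1\<^sub>m 1)
      (0\<^sub>m 1 n * B + 1\<^sub>m 1 * 0\<^sub>m 1 n) (0\<^sub>m 1 n * ?c w + 1\<^sub>m 1 * 1\<^sub>m 1)"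
    unfolding blk_def carrier_matD(2)[OF A] carrier_matD(2)[OF B] carrier_vecD[OF v] carrier_vecD[OF w]
    using A B by (intro mult_four_block_mat[of _ n n _ 1 _ 1]) auto
  moreover have "A * B + ?c v * 0\<^sub>m 1 n = A * B"
    using AB by (simp add: right_mult_zero_mat[of _ n 1 n])
  moreover have "A * ?c w + ?c v * 1\<^sub>m 1 = ?c (A *\<^sub>v w + v)"
  proof (rule eq_matI)
    fix i j assume "i < dim_row (?c (A *\<^sub>v w + v))" "j < dim_col (?c (A *\<^sub>v w + v))"
    then have i: "i < n" and j: "j = 0" by auto
    have "col (?c w) 0 = w" using w by simp
    then show "(A * ?c w + ?c v * 1\<^sub>m 1) $$ (i, j) = ?c (A *\<^sub>v w + v) $$ (i, j)"
      using i j A v w by (simp add: mat_of_cols_index)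
  qed (use A in auto)
  moreover have "0\<^sub>m 1 n * B + 1\<^sub>m 1 * 0\<^sub>m 1 n = 0\<^sub>m 1 n"
    using B by (simp add: left_mult_zero_mat[of _ n n])
  moreover have "0\<^sub>m 1 n * ?c w + 1\<^sub>m 1 * 1\<^sub>m 1 = 1\<^sub>m 1"
    by (simp add: left_mult_zero_mat[of _ n 1])
  ultimately show ?thesis using AB Aw v B unfolding blk_def by simp
qed

lemma blk_eq_iff:
  assumes "A \<in> carrier_mat n n" "B \<in> carrier_mat n n" "v \<in> carrier_vec n" "w \<in> carrier_vec n"
  shows "blk A v = blk B w \<longleftrightarrow> A = B \<and> v = w"
proof
  assume eq: "blk A v = blk B w"
  have "A $$ (i, j) = B $$ (i, j)" if "i < n" "j < n" for i j
    using arg_cong[OF eq, of "\<lambda>R. R $$ (i, j)"] that assms by (simp add: blk_def)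
  moreover have "v $ i = w $ i" if "i < n" for i
    using arg_cong[OF eq, of "\<lambda>R. R $$ (i, n)"] that assms by (simp add: blk_def mat_of_cols_index)
  ultimately show "A = B \<and> v = w"
    using assms by (intro conjI eq_matI eq_vecI) auto
qed simp

lemma blk_one: "blk (1\<^sub>m n) (0\<^sub>v n) = 1\<^sub>m (n + 1)"
  by (intro eq_matI) (auto simp: blk_def mat_of_cols_index)

lemma GL_simps [simp]: "x \<otimes>\<^bsub>GL n\<^esub> y = x * y" "\<one>\<^bsub>GL n\<^esub> = 1\<^sub>m n"
  by (simp_all add: GL_def units_of_def ring_mat_simps)

lemma group_GL: "group (GL n :: 'a :: field mat monoid)"
proof -
  interpret ring "ring_mat TYPE('a) n ()" by (rule ring_mat)
  show ?thesis unfolding GL_def by (rule units_group)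
qed

lemma GL_carrierD: "A \<in> carrier (GL n) \<Longrightarrow> A \<in> carrier_mat n n"
  by (auto simp: GL_def units_of_def Units_def ring_mat_simps)

lemma GL_inverse:
  fixes S T :: "'a :: field mat"
  assumes "S \<in> carrier_mat n n" "T \<in> carrier_mat n n" "S * T = 1\<^sub>m n" "T * S = 1\<^sub>m n"
  shows "S \<in> carrier (GL n)" and "inv\<^bsub>GL n\<^esub> S = T"
proof -
  have *: "S \<in> carrier (GL n)" "T \<in> carrier (GL n)"
    using assms by (auto simp: GL_def units_of_def Units_def ring_mat_simps)
  then show "S \<in> carrier (GL n)" by simp
  show "inv\<^bsub>GL n\<^esub> S = T"
    by (rule group.inv_equality[OF group_GL]) (use * assms in simp_all)
qed

lemma GL_pow:
  fixes A :: "'a :: field mat"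
  assumes "A \<in> carrier (GL n)"
  shows "A [^]\<^bsub>GL n\<^esub> (k :: nat) = A ^\<^sub>m k"
proof (induct k)
  case 0
  interpret group "GL n :: 'a mat monoid" by (rule group_GL)
  show ?case using GL_carrierD[OF assms] by simp
next
  case (Suc k)
  interpret group "GL n :: 'a mat monoid" by (rule group_GL)
  show ?case using Suc by simp
qed

text \<open>Makes \<open>(n - 1) * a\<close> the negative of \<open>a\<close> modulo
  \<open>n\<close>. Exponents can stay natural numbers, and inverses of powers of \<open>M\<close>
  and \<open>J\<close> are written as powers again.\<close>

lemma pred_mult_add: "0 < n \<Longrightarrow> (n - 1) * a + a = n * a" for n a :: nat
  by (cases n) auto

section \<open>The group \<open>N\<close> in coordinates\<close>

locale brace_setup =
  fixes p q :: nat and M :: "'p :: prime_card mod_ring mat"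
  assumes p: "Factorial_Ring.prime p" and q: "Factorial_Ring.prime q" and card_p: "CARD('p) = p"
    and q_dvd: "q dvd (p ^ p - 1) div (p - 1)"
    and M_GL: "M \<in> carrier (GL p)"
    and ord_M: "group.ord (GL p) M = q"
    and JM: "jordan_block p 1 \<otimes>\<^bsub>GL p\<^esub> M \<otimes>\<^bsub>GL p\<^esub> inv\<^bsub>GL p\<^esub> (jordan_block p 1) = M [^]\<^bsub>GL p\<^esub> p"
begin

abbreviation J :: "'p mod_ring mat" where "J \<equiv> jordan_block p 1"
abbreviation V :: "'p mod_ring vec set" where "V \<equiv> carrier_vec p"
abbreviation Mat :: "'p mod_ring mat set" where "Mat \<equiv> carrier_mat p p"
abbreviation N :: "'p mod_ring mat monoid" where "N \<equiv> N_group p q M"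

lemma p_gt_1: "p > 1" and p_gt_0: "p > 0" and q_gt_1: "q > 1" and q_gt_0: "q > 0"
  using p q prime_gt_1_nat prime_gt_0_nat by auto

lemma M_carrier [simp]: "M \<in> Mat"
  by (rule GL_carrierD[OF M_GL])

lemma M_dim [simp]: "dim_row M = p" "dim_col M = p"
  using carrier_matD[OF M_carrier] by simp_all

lemma M_pow_carrier [simp]: "M ^\<^sub>m k \<in> Mat"
  by (rule pow_carrier_mat) simp

lemma J_pow_carrier [simp]: "J ^\<^sub>m k \<in> Mat"
  by (rule pow_carrier_mat) simp

lemma mat_mult_closed [simp]: "A \<in> Mat \<Longrightarrow> B \<in> Mat \<Longrightarrow> A * B \<in> Mat"
  by (rule mult_carrier_mat)

lemma mat_assoc: "A \<in> Mat \<Longrightarrow> B \<in> Mat \<Longrightarrow> C \<in> Mat \<Longrightarrow> A * B * C = A * (B * C)"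
  by (rule assoc_mult_mat)

lemma mat_mult_one [simp]: "A \<in> Mat \<Longrightarrow> A * 1\<^sub>m p = A" "A \<in> Mat \<Longrightarrow> 1\<^sub>m p * A = A"
  by (rule right_mult_one_mat left_mult_one_mat, assumption)+

lemma mat_vec_closed [simp]: "A \<in> Mat \<Longrightarrow> v \<in> V \<Longrightarrow> A *\<^sub>v v \<in> V"
  by (rule mult_mat_vec_carrier)

lemma mat_vec_assoc: "A \<in> Mat \<Longrightarrow> B \<in> Mat \<Longrightarrow> v \<in> V \<Longrightarrow> A * B *\<^sub>v v = A *\<^sub>v (B *\<^sub>v v)"
  by (rule assoc_mult_mat_vec)

lemma mat_vec_add: "A \<in> Mat \<Longrightarrow> v \<in> V \<Longrightarrow> w \<in> V \<Longrightarrow> A *\<^sub>v (v + w) = A *\<^sub>v v + A *\<^sub>v w"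
  by (rule mult_add_distrib_mat_vec)

lemma M_pow_add: "M ^\<^sub>m (a + b) = M ^\<^sub>m a * M ^\<^sub>m b"
  by (rule pow_mat_add[of _ p]) simp

lemma J_pow_add: "J ^\<^sub>m (a + b) = J ^\<^sub>m a * J ^\<^sub>m b"
  by (rule pow_mat_add[of _ p]) simp

lemma M_pow_add_vec: "v \<in> V \<Longrightarrow> M ^\<^sub>m (a + b) *\<^sub>v v = M ^\<^sub>m a *\<^sub>v (M ^\<^sub>m b *\<^sub>v v)"
  by (simp add: M_pow_add mat_vec_assoc)

lemma J_pow_add_vec: "v \<in> V \<Longrightarrow> J ^\<^sub>m (a + b) *\<^sub>v v = J ^\<^sub>m a *\<^sub>v (J ^\<^sub>m b *\<^sub>v v)"
  by (simp add: J_pow_add mat_vec_assoc)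

lemma M_pow_eq_1_iff: "M ^\<^sub>m a = 1\<^sub>m p \<longleftrightarrow> q dvd a"
  using group.pow_eq_id[OF group_GL M_GL, of a] by (simp add: GL_pow[OF M_GL] ord_M)

lemma M_pow_inverse: "M ^\<^sub>m ((q - 1) * a) * M ^\<^sub>m a = 1\<^sub>m p" "M ^\<^sub>m a * M ^\<^sub>m ((q - 1) * a) = 1\<^sub>m p"
proof -
  have "q dvd (q - 1) * a + a" "q dvd a + (q - 1) * a"
    using pred_mult_add[OF q_gt_0, of a] by (simp_all add: add.commute)
  then show "M ^\<^sub>m ((q - 1) * a) * M ^\<^sub>m a = 1\<^sub>m p" "M ^\<^sub>m a * M ^\<^sub>m ((q - 1) * a) = 1\<^sub>m p"
    by (simp_all only: M_pow_add[symmetric] M_pow_eq_1_iff)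
qed

lemma M_pow_eq_iff: "M ^\<^sub>m a = M ^\<^sub>m b \<longleftrightarrow> [a = b] (mod q)"
proof -
  have *: "M ^\<^sub>m a = M ^\<^sub>m b \<longleftrightarrow> [a = b] (mod q)" if "a \<le> b" for a b
  proof -
    have "M ^\<^sub>m a = M ^\<^sub>m b \<longleftrightarrow> M ^\<^sub>m (b - a) = 1\<^sub>m p"
    proof
      assume "M ^\<^sub>m a = M ^\<^sub>m b"
      then have "M ^\<^sub>m (b - a) * M ^\<^sub>m a = M ^\<^sub>m a"
        using that M_pow_add[of "b - a" a] by (metis le_add_diff_inverse2)
      then have "M ^\<^sub>m (b - a) * (M ^\<^sub>m a * M ^\<^sub>m ((q - 1) * a)) = M ^\<^sub>m a * M ^\<^sub>m ((q - 1) * a)"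
        by (metis mat_assoc M_pow_carrier)
      then show "M ^\<^sub>m (b - a) = 1\<^sub>m p"
        by (simp add: M_pow_inverse[unfolded One_nat_def])
    next
      assume "M ^\<^sub>m (b - a) = 1\<^sub>m p"
      then show "M ^\<^sub>m a = M ^\<^sub>m b"
        using that M_pow_add[of "b - a" a] by simp
    qed
    then show ?thesis
      using that by (simp add: M_pow_eq_1_iff cong_altdef_nat cong_sym_eq[of a b])
  qed
  show ?thesis
    using *[of a b] *[of b a] by (cases "a \<le> b") (auto simp: cong_sym_eq)
qed

lemma J_pow_p: "J ^\<^sub>m p = 1\<^sub>m p"
  by (rule jordan_block_pow_prime[OF p card_p])

lemma J_pow_multiple: "J ^\<^sub>m (p * a) = 1\<^sub>m p"
proof (induct a)
  case (Suc a)
  then show ?case by (simp add: J_pow_add J_pow_p)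
qed simp

lemma J_pow_cong:
  assumes "[c = d] (mod p)"
  shows "J ^\<^sub>m c = J ^\<^sub>m d"
proof -
  have *: "J ^\<^sub>m c = J ^\<^sub>m (c mod p)" for c
    using J_pow_add[of "p * (c div p)" "c mod p"] by (simp add: J_pow_multiple)
  show ?thesis using assms *[of c] *[of d] by (simp add: cong_def)
qed

lemma J_pow_inverse: "J ^\<^sub>m ((p - 1) * a) * J ^\<^sub>m a = 1\<^sub>m p" "J ^\<^sub>m a * J ^\<^sub>m ((p - 1) * a) = 1\<^sub>m p"
proof -
  have "(p - 1) * a + a = p * a" "a + (p - 1) * a = p * a"
    using pred_mult_add[OF p_gt_0, of a] by (simp_all add: add.commute)
  then show "J ^\<^sub>m ((p - 1) * a) * J ^\<^sub>m a = 1\<^sub>m p" "J ^\<^sub>m a * J ^\<^sub>m ((p - 1) * a) = 1\<^sub>m p"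
    using J_pow_multiple by (simp_all only: J_pow_add[symmetric])
qed

lemma J_M: "J * M = M ^\<^sub>m p * J"
proof -
  let ?I = "J ^\<^sub>m (p - 1)"
  have "inv\<^bsub>GL p\<^esub> J = ?I"
    using J_pow_inverse[of 1] by (intro GL_inverse) simp_all
  then have "J * M * ?I = M ^\<^sub>m p"
    using JM by (simp add: GL_pow[OF M_GL])
  then have "J * M * (?I * J) = M ^\<^sub>m p * J"
    by (metis mat_assoc mat_mult_closed J_pow_carrier M_carrier jordan_block_carrier)
  then show ?thesis using J_pow_inverse(1)[of 1] by simp
qed

lemma J_M_pow: "J * M ^\<^sub>m a = M ^\<^sub>m (p * a) * J"
proof (induct a)
  case (Suc a)
  have "J * M ^\<^sub>m Suc a = (J * M ^\<^sub>m a) * M" by (simp add: mat_assoc)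
  also have "\<dots> = M ^\<^sub>m (p * a) * (J * M)" by (simp add: Suc mat_assoc)
  also have "\<dots> = M ^\<^sub>m (p * a) * M ^\<^sub>m p * J" by (simp add: J_M mat_assoc)
  finally show ?case by (simp add: M_pow_add[symmetric] add.commute)
qed simp

text \<open>Each factor \<open>J\<close> that passes a power of \<open>M\<close> multiplies the
  exponent by \<open>p\<close>. This is the source of \<open>p ^ c\<close> in the circle
  product.\<close>

lemma J_pow_M_pow: "J ^\<^sub>m c * M ^\<^sub>m a = M ^\<^sub>m (p ^ c * a) * J ^\<^sub>m c"
proof (induct c arbitrary: a)
  case (Suc c)
  have "J ^\<^sub>m Suc c * M ^\<^sub>m a = J ^\<^sub>m c * (J * M ^\<^sub>m a)" by (simp add: mat_assoc)
  also have "\<dots> = (J ^\<^sub>m c * M ^\<^sub>m (p * a)) * J" by (simp add: J_M_pow mat_assoc)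
  also have "\<dots> = M ^\<^sub>m (p ^ c * (p * a)) * J ^\<^sub>m c * J" by (simp only: Suc)
  finally show ?case by (simp add: mat_assoc mult_ac)
qed simp

lemma J_conj_M_pow: "J ^\<^sub>m c * M ^\<^sub>m a * J ^\<^sub>m ((p - 1) * c) = M ^\<^sub>m (p ^ c * a)"
  by (simp add: J_pow_M_pow mat_assoc J_pow_inverse[simplified])

lemma p_pow_cong:
  assumes "[c = d] (mod p)"
  shows "[p ^ c = p ^ d] (mod q)"
proof -
  have "[p ^ (p * k) = 1] (mod q)" for k
    using cong_power_one_iff_dvd[OF p q q_dvd] by simp
  then have "[p ^ (p * (c div p)) * p ^ (c mod p) = 1 * p ^ (c mod p)] (mod q)" for c
    by (intro cong_mult) auto
  then have "[p ^ c = p ^ (c mod p)] (mod q)" for c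
    by (simp flip: power_add)
  then show ?thesis using assms by (metis cong_def)
qed

text \<open>The factor \<open>M ^\<^sub>m a\<close> in front of \<open>v\<close> makes
  \<open>M\<close> disappear from the second coordinate of the circle product, see
  \<open>circ_el\<close>. The exponent is any natural number and matters modulo \<open>q\<close>,
  see \<open>el_eq_iff\<close>.\<close>

definition el :: "nat \<Rightarrow> 'p mod_ring vec \<Rightarrow> 'p mod_ring mat" where
  "el a v = blk (M ^\<^sub>m a) (M ^\<^sub>m a *\<^sub>v v)"

lemma el_carrier_mat: "v \<in> V \<Longrightarrow> el a v \<in> carrier_mat (p + 1) (p + 1)"
  unfolding el_def by (intro blk_carrier) simp_all

text \<open>The vector \<open>M ^\<^sub>m b *\<^sub>v v\<close> on the left avoids a negative power
  of \<open>M\<close>; \<open>el_mult'\<close> is the form for an arbitrary left factor.\<close>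

lemma el_mult:
  assumes "v \<in> V" "w \<in> V"
  shows "el a (M ^\<^sub>m b *\<^sub>v v) * el b w = el (a + b) (v + w)"
  unfolding el_def using assms
  by (simp add: blk_mult[of _ p] M_pow_add mat_vec_assoc mat_vec_add comm_add_vec[of _ p])

lemma el_cong: "[a = b] (mod q) \<Longrightarrow> el a v = el b v"
  unfolding el_def by (simp add: M_pow_eq_iff[THEN iffD2])

lemma M_pow_vec_cancel:
  assumes "M ^\<^sub>m a *\<^sub>v v = M ^\<^sub>m a *\<^sub>v w" "v \<in> V" "w \<in> V"
  shows "v = w"
proof -
  have "M ^\<^sub>m ((q - 1) * a) *\<^sub>v (M ^\<^sub>m a *\<^sub>v v) = M ^\<^sub>m ((q - 1) * a) *\<^sub>v (M ^\<^sub>m a *\<^sub>v w)"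
    by (simp only: assms(1))
  then show ?thesis using assms(2,3) by (simp add: mat_vec_assoc[symmetric] M_pow_inverse[simplified])
qed

lemma el_eq_iff:
  assumes "v \<in> V" "w \<in> V"
  shows "el a v = el b w \<longleftrightarrow> [a = b] (mod q) \<and> v = w"
  unfolding el_def using assms M_pow_vec_cancel[of b v w]
  by (auto simp: blk_eq_iff[of _ p] M_pow_eq_iff[symmetric])

lemma carrier_N: "carrier N = {el a v | a v. v \<in> V}"
proof -
  have "blk (M [^]\<^bsub>GL p\<^esub> k) v \<in> {el a v | a v. v \<in> V}" if "v \<in> V" for k :: nat and v
  proof -
    have "blk (M [^]\<^bsub>GL p\<^esub> k) v = el k (M ^\<^sub>m ((q - 1) * k) *\<^sub>v v)"
      using that by (simp add: GL_pow[OF M_GL] el_def mat_vec_assoc[symmetric] M_pow_inverse[simplified])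
    moreover have "M ^\<^sub>m ((q - 1) * k) *\<^sub>v v \<in> V" using that by simp
    ultimately show ?thesis by blast
  qed
  moreover have "\<exists>k w. el a v = blk (M [^]\<^bsub>GL p\<^esub> k) w \<and> k < q \<and> w \<in> V" if "v \<in> V" for a v
  proof (intro exI conjI)
    show "el a v = blk (M [^]\<^bsub>GL p\<^esub> (a mod q)) (M ^\<^sub>m (a mod q) *\<^sub>v v)"
      using el_cong[of a "a mod q" v] by (simp add: GL_pow[OF M_GL] el_def[of "a mod q"])
  qed (use that q_gt_0 in simp_all)
  ultimately show ?thesis unfolding N_group_def by auto
qed

lemma el_in_N [simp]: "v \<in> V \<Longrightarrow> el a v \<in> carrier N"
  by (auto simp: carrier_N)

lemma N_simps [simp]: "x \<otimes>\<^bsub>N\<^esub> y = x * y" "\<one>\<^bsub>N\<^esub> = 1\<^sub>m (p + 1)"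
  by (simp_all add: N_group_def)

lemma el_0_0: "el 0 (0\<^sub>v p) = 1\<^sub>m (p + 1)"
  by (simp add: el_def blk_one)

lemma N_carrier_mat: "R \<in> carrier N \<Longrightarrow> R \<in> carrier_mat (p + 1) (p + 1)"
  using el_carrier_mat by (auto simp: carrier_N)

lemma el_mult':
  assumes "v \<in> V" "w \<in> V"
  shows "el a v * el b w = el (a + b) (M ^\<^sub>m ((q - 1) * b) *\<^sub>v v + w)"
  using el_mult[of "M ^\<^sub>m ((q - 1) * b) *\<^sub>v v" w a b] assms
  by (simp add: mat_vec_assoc[symmetric] M_pow_inverse[simplified])

lemma group_N: "group N"
proof (rule groupI)
  fix x y z assume x: "x \<in> carrier N" and y: "y \<in> carrier N" and z: "z \<in> carrier N"
  show "x \<otimes>\<^bsub>N\<^esub> y \<in> carrier N"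
  proof -
    obtain a v b w where "x = el a v" "y = el b w" "v \<in> V" "w \<in> V"
      using x y by (auto simp: carrier_N)
    then show ?thesis by (simp add: el_mult')
  qed
  show "x \<otimes>\<^bsub>N\<^esub> y \<otimes>\<^bsub>N\<^esub> z = x \<otimes>\<^bsub>N\<^esub> (y \<otimes>\<^bsub>N\<^esub> z)"
    unfolding N_simps by (rule assoc_mult_mat[OF x[THEN N_carrier_mat] y[THEN N_carrier_mat] z[THEN N_carrier_mat]])
next
  show "\<one>\<^bsub>N\<^esub> \<in> carrier N" using el_in_N[of "0\<^sub>v p" 0] by (simp add: el_0_0)
next
  fix x assume x: "x \<in> carrier N"
  then show "\<one>\<^bsub>N\<^esub> \<otimes>\<^bsub>N\<^esub> x = x" using N_carrier_mat[OF x] by simp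
  obtain a v where av: "x = el a v" "v \<in> V" using x by (auto simp: carrier_N)
  have "el ((q - 1) * a) (M ^\<^sub>m a *\<^sub>v (- v)) * el a v = el ((q - 1) * a + a) (- v + v)"
    using av by (intro el_mult) auto
  also have "- v + v = 0\<^sub>v p" using av by (auto intro: uminus_l_inv_vec)
  also have "el ((q - 1) * a + a) (0\<^sub>v p) = el 0 (0\<^sub>v p)"
    by (intro el_cong) (simp only: pred_mult_add[OF q_gt_0] cong_def mod_mult_self1_is_0 mod_0)
  finally have "el ((q - 1) * a) (M ^\<^sub>m a *\<^sub>v (- v)) \<otimes>\<^bsub>N\<^esub> x = \<one>\<^bsub>N\<^esub>"
    by (simp add: av(1) el_0_0)
  moreover have "el ((q - 1) * a) (M ^\<^sub>m a *\<^sub>v (- v)) \<in> carrier N" using av by simp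
  ultimately show "\<exists>y\<in>carrier N. y \<otimes>\<^bsub>N\<^esub> x = \<one>\<^bsub>N\<^esub>" by blast
qed

lemma finite_N: "finite (carrier N)"
proof -
  have "carrier N \<subseteq> (\<lambda>(a, v). el a v) ` ({..<q} \<times> V)"
  proof
    fix x assume "x \<in> carrier N"
    then obtain a v where "x = el a v" "v \<in> V" by (auto simp: carrier_N)
    then have "x = el (a mod q) v" "(a mod q, v) \<in> {..<q} \<times> V"
      using el_cong[of a "a mod q" v] q_gt_0 by auto
    then show "x \<in> (\<lambda>(a, v). el a v) ` ({..<q} \<times> V)" by force
  qed
  then show ?thesis by (rule finite_subset) simp
qed

section \<open>The regular subgroup and the circle operation\<close>

lemma vec_uminus_closed: "v \<in> V \<Longrightarrow> - v \<in> V"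
  by simp

lemma vec_add_closed: "v \<in> V \<Longrightarrow> w \<in> V \<Longrightarrow> v + w \<in> V"
  by simp

lemmas mat_intros = M_pow_carrier J_pow_carrier mat_mult_closed mat_vec_closed
  vec_add_closed vec_uminus_closed

section \<open>Conjugation automorphisms of \<open>N\<close>\<close>

lemma conj_N_auto:
  assumes S: "S \<in> carrier_mat (p + 1) (p + 1)" and T: "T \<in> carrier_mat (p + 1) (p + 1)"
    and ST: "S * T = 1\<^sub>m (p + 1)" and TS: "T * S = 1\<^sub>m (p + 1)"
    and closed: "\<And>R. R \<in> carrier N \<Longrightarrow> S * R * T \<in> carrier N"
  shows "conj_N p q M S \<in> auto N"
    and "R \<in> carrier N \<Longrightarrow> conj_N p q M S R = S * R * T"
proof -
  have inv: "inv\<^bsub>GL (p + 1)\<^esub> S = T" by (rule GL_inverse(2)[OF S T ST TS])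
  have eq: "conj_N p q M S R = S * R * T" if "R \<in> carrier N" for R
    using that unfolding conj_N_def inv GL_simps by simp
  then show "R \<in> carrier N \<Longrightarrow> conj_N p q M S R = S * R * T" .
  note assoc = assoc_mult_mat[of _ "p + 1" "p + 1" _ "p + 1" _ "p + 1"]
  note mc = mult_carrier_mat[of _ "p + 1" "p + 1" _ "p + 1"]
  have cancel: "T * (S * R * T) * S = R" if R: "R \<in> carrier_mat (p + 1) (p + 1)" for R
  proof -
    have "T * (S * R * T) * S = (T * S) * R * (T * S)"
      using S T R by (simp only: assoc mc)
    then show ?thesis using TS R by simp
  qed
  have hom: "S * (P * R) * T = (S * P * T) * (S * R * T)"
    if P: "P \<in> carrier_mat (p + 1) (p + 1)" and R: "R \<in> carrier_mat (p + 1) (p + 1)" for P R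
  proof -
    have "(S * P * T) * (S * R * T) = S * (P * ((T * S) * (R * T)))"
      using S T P R by (simp only: assoc mc)
    also have "\<dots> = S * (P * R) * T"
      unfolding TS using S T P R by (simp only: assoc mc left_mult_one_mat[of _ "p + 1" "p + 1"])
    finally show ?thesis by simp
  qed
  have inj: "inj_on (conj_N p q M S) (carrier N)"
    by (rule inj_on_inverseI[where g = "\<lambda>R. T * R * S"]) (simp only: eq cancel N_carrier_mat)
  have img: "conj_N p q M S ` carrier N \<subseteq> carrier N"
    using eq closed by auto
  \<comment> \<open>An injective map from the finite set \<open>carrier N\<close> to itself is onto,
    so closure under conjugation in one direction is enough.\<close>
  have "conj_N p q M S \<in> Bij (carrier N)"
    unfolding Bij_def bij_betw_def using inj endo_inj_surj[OF finite_N img inj]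
    by (auto simp: conj_N_def)
  moreover have "conj_N p q M S \<in> hom N N"
  proof (rule homI)
    fix x y assume x: "x \<in> carrier N" and y: "y \<in> carrier N"
    show "conj_N p q M S x \<in> carrier N" using x eq closed by simp
    have "x * y \<in> carrier N" using monoid.m_closed[OF group.is_monoid[OF group_N] x y] by simp
    then show "conj_N p q M S (x \<otimes>\<^bsub>N\<^esub> y) = conj_N p q M S x \<otimes>\<^bsub>N\<^esub> conj_N p q M S y"
      using hom[OF N_carrier_mat[OF x] N_carrier_mat[OF y]] eq x y by simp
  qed
  ultimately show "conj_N p q M S \<in> auto N" by (simp add: auto_def)
qed

text \<open>A natural representative of the last coordinate, so that it can serve as an exponent of
  \<open>J\<close> and of \<open>p\<close>. Taking the least one makes it exactly 0 or 1 on the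
  generators of \<open>G\<close>.\<close>

definition lastc :: "'p mod_ring vec \<Rightarrow> nat" where
  "lastc v = (LEAST i. of_nat i = v $ (p - 1))"

lemma of_nat_lastc: "of_nat (lastc v) = v $ (p - 1)"
  unfolding lastc_def using surj_of_nat_mod_ring[of "v $ (p - 1)"] by (metis (mono_tags, lifting) LeastI)

lemma of_nat_eq_iff_cong: "(of_nat a :: 'p mod_ring) = of_nat b \<longleftrightarrow> [a = b] (mod p)"
  by (simp add: of_nat_eq_iff_cong_CHAR card_p)

lemma lastc_congI: "v $ (p - 1) = of_nat a \<Longrightarrow> [lastc v = a] (mod p)"
  by (simp add: of_nat_lastc flip: of_nat_eq_iff_cong)

lemma J_pow_last: "v \<in> V \<Longrightarrow> (J ^\<^sub>m c *\<^sub>v v) $ (p - 1) = v $ (p - 1)"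
proof (induct c)
  case (Suc c)
  have "J ^\<^sub>m Suc c *\<^sub>v v = J *\<^sub>v (J ^\<^sub>m c *\<^sub>v v)"
    using Suc J_pow_add_vec[of v 1 c] by simp
  then show ?case
    using Suc index_jordan_block_1_mult_vec_last[of "J ^\<^sub>m c *\<^sub>v v" p] p_gt_0 by simp
qed simp

lemma add_last:
  "v \<in> V \<Longrightarrow> w \<in> V \<Longrightarrow> (v + w) $ (p - 1) = v $ (p - 1) + w $ (p - 1)"
  using p_gt_0 by simp

definition S_mat :: "nat \<Rightarrow> 'p mod_ring vec \<Rightarrow> 'p mod_ring mat" where
  "S_mat c v = blk (J ^\<^sub>m c) (- v)"

text \<open>The inverse of \<open>S_mat c v\<close>: the sign of its translation part cancels the
  one in \<open>S_mat\<close>, and the negative power of \<open>J\<close> is written with exponent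
  \<open>(p - 1) * c\<close>.\<close>

definition S_inv :: "nat \<Rightarrow> 'p mod_ring vec \<Rightarrow> 'p mod_ring mat" where
  "S_inv c v = blk (J ^\<^sub>m ((p - 1) * c)) (J ^\<^sub>m ((p - 1) * c) *\<^sub>v v)"

lemma S_mat_carrier: "v \<in> V \<Longrightarrow> S_mat c v \<in> carrier_mat (p + 1) (p + 1)"
  unfolding S_mat_def by (intro blk_carrier mat_intros)

lemma S_inv_carrier: "v \<in> V \<Longrightarrow> S_inv c v \<in> carrier_mat (p + 1) (p + 1)"
  unfolding S_inv_def by (intro blk_carrier mat_intros)

lemma mat_vec_uminus: "A \<in> Mat \<Longrightarrow> v \<in> V \<Longrightarrow> A *\<^sub>v (- v) = - (A *\<^sub>v v)"
  by (rule eq_vecI) auto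

lemma vec_minus_self: "v \<in> V \<Longrightarrow> v + - v = 0\<^sub>v p" "v \<in> V \<Longrightarrow> - v + v = 0\<^sub>v p"
  by auto

lemma S_mat_inverse:
  assumes "v \<in> V"
  shows "S_mat c v * S_inv c v = 1\<^sub>m (p + 1)" "S_inv c v * S_mat c v = 1\<^sub>m (p + 1)"
proof -
  let ?D = "J ^\<^sub>m ((p - 1) * c)"
  have D: "J ^\<^sub>m c * ?D = 1\<^sub>m p" "?D * J ^\<^sub>m c = 1\<^sub>m p" by (rule J_pow_inverse)+
  have "S_mat c v * S_inv c v = blk (J ^\<^sub>m c * ?D) (J ^\<^sub>m c *\<^sub>v (?D *\<^sub>v v) + - v)"
    unfolding S_mat_def S_inv_def using assms by (intro blk_mult[of _ p] mat_intros)
  also have "J ^\<^sub>m c *\<^sub>v (?D *\<^sub>v v) = (J ^\<^sub>m c * ?D) *\<^sub>v v"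
    using assms by (intro mat_vec_assoc[symmetric] mat_intros)
  finally show "S_mat c v * S_inv c v = 1\<^sub>m (p + 1)"
    unfolding D using assms blk_one[of p] by (simp add: vec_minus_self)
  have "S_inv c v * S_mat c v = blk (?D * J ^\<^sub>m c) (?D *\<^sub>v (- v) + ?D *\<^sub>v v)"
    unfolding S_mat_def S_inv_def using assms by (intro blk_mult[of _ p] mat_intros)
  also have "?D *\<^sub>v (- v) + ?D *\<^sub>v v = 0\<^sub>v p"
    using assms by (simp only: mat_vec_uminus J_pow_carrier vec_minus_self mat_vec_closed)
  finally show "S_inv c v * S_mat c v = 1\<^sub>m (p + 1)"
    unfolding D using blk_one[of p] by simp
qed

text \<open>\<open>el a v\<close> ends with the translation by \<open>v\<close>, and
  \<open>S_mat c v\<close> begins with the translation by \<open>- v\<close>. They cancel, which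
  leaves M^a J^c \<open>el b w\<close> times the inverse of S. Here \<open>c\<close> is arbitrary:
  the circle product takes \<open>c = lastc v\<close>, and \<open>sigma_el\<close> takes
  \<open>v\<close> to be zero.\<close>

lemma el_mult_S_conj:
  assumes v: "v \<in> V" and w: "w \<in> V"
  shows "el a v * (S_mat c v * el b w * S_inv c v) = el (a + p ^ c * b) (v + J ^\<^sub>m c *\<^sub>v w)"
proof -
  let ?D = "J ^\<^sub>m ((p - 1) * c)" and ?B = "M ^\<^sub>m (p ^ c * b)" and ?C = "J ^\<^sub>m c"
  have CM: "?C * M ^\<^sub>m b = ?B * ?C" by (rule J_pow_M_pow)
  have CMD: "?C * M ^\<^sub>m b * ?D = ?B" by (rule J_conj_M_pow)
  have 1: "S_mat c v * el b w = blk (?C * M ^\<^sub>m b) (?B *\<^sub>v (?C *\<^sub>v w) + - v)"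
  proof -
    have "S_mat c v * el b w = blk (?C * M ^\<^sub>m b) (?C *\<^sub>v (M ^\<^sub>m b *\<^sub>v w) + - v)"
      unfolding S_mat_def el_def using assms by (intro blk_mult[of _ p] mat_intros)
    also have "?C *\<^sub>v (M ^\<^sub>m b *\<^sub>v w) = (?C * M ^\<^sub>m b) *\<^sub>v w"
      using w by (simp add: mat_vec_assoc)
    also have "\<dots> = ?B *\<^sub>v (?C *\<^sub>v w)"
      unfolding CM using w by (simp add: mat_vec_assoc)
    finally show ?thesis .
  qed
  have "S_mat c v * el b w * S_inv c v = blk (?C * M ^\<^sub>m b * ?D)
      ((?C * M ^\<^sub>m b) *\<^sub>v (?D *\<^sub>v v) + (?B *\<^sub>v (?C *\<^sub>v w) + - v))"
    unfolding 1 unfolding S_inv_def using assms by (intro blk_mult[of _ p] mat_intros)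
  also have "(?C * M ^\<^sub>m b) *\<^sub>v (?D *\<^sub>v v) = (?C * M ^\<^sub>m b * ?D) *\<^sub>v v"
    using v by (intro mat_vec_assoc[symmetric] mat_intros)
  finally have 2: "S_mat c v * el b w * S_inv c v = blk ?B (?B *\<^sub>v v + (?B *\<^sub>v (?C *\<^sub>v w) + - v))"
    unfolding CMD .
  have "el a v * (S_mat c v * el b w * S_inv c v) =
      blk (M ^\<^sub>m a * ?B) (M ^\<^sub>m a *\<^sub>v (?B *\<^sub>v v + (?B *\<^sub>v (?C *\<^sub>v w) + - v)) + M ^\<^sub>m a *\<^sub>v v)"
    unfolding 2 unfolding el_def using assms by (intro blk_mult[of _ p] mat_intros)
  also have "M ^\<^sub>m a *\<^sub>v (?B *\<^sub>v v + (?B *\<^sub>v (?C *\<^sub>v w) + - v)) + M ^\<^sub>m a *\<^sub>v v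
      = M ^\<^sub>m a *\<^sub>v (?B *\<^sub>v v + (?B *\<^sub>v (?C *\<^sub>v w) + - v) + v)"
    using assms by (simp add: mat_vec_add)
  also have "?B *\<^sub>v v + (?B *\<^sub>v (?C *\<^sub>v w) + - v) + v = ?B *\<^sub>v v + ?B *\<^sub>v (?C *\<^sub>v w)"
    using carrier_vecD[OF v] carrier_vecD[OF mat_vec_closed[OF M_pow_carrier v]]
      carrier_vecD[OF mat_vec_closed[OF M_pow_carrier mat_vec_closed[OF J_pow_carrier w]]]
    by (intro eq_vecI) simp_all
  also have "\<dots> = ?B *\<^sub>v (v + ?C *\<^sub>v w)"
    using assms by (simp add: mat_vec_add)
  finally show ?thesis
    unfolding el_def using assms by (simp add: M_pow_add mat_vec_assoc)
qed

text \<open>By \<open>el_mult_S_conj\<close> the product of \<open>el 0 v\<close> with the conjugate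
  lies in \<open>N\<close>; dividing by \<open>el 0 v\<close> gives the conjugate itself.\<close>

lemma S_conj_closed:
  assumes "v \<in> V" "R \<in> carrier N"
  shows "S_mat c v * R * S_inv c v \<in> carrier N"
proof -
  interpret N: group N by (rule group_N)
  obtain b w where R: "R = el b w" "w \<in> V" using assms by (auto simp: carrier_N)
  let ?P = "S_mat c v * R * S_inv c v"
  have P: "?P \<in> carrier_mat (p + 1) (p + 1)"
    using assms S_mat_carrier S_inv_carrier N_carrier_mat by (meson mult_carrier_mat)
  have e: "el 0 v * ?P \<in> carrier N" unfolding R(1) using assms R by (simp add: el_mult_S_conj)
  have i: "inv\<^bsub>N\<^esub> el 0 v \<in> carrier N" "inv\<^bsub>N\<^esub> el 0 v * el 0 v = 1\<^sub>m (p + 1)"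
    using N.l_inv[of "el 0 v"] assms by simp_all
  have "?P = (inv\<^bsub>N\<^esub> el 0 v * el 0 v) * ?P"
    unfolding i(2) by (rule left_mult_one_mat[OF P, symmetric])
  also have "\<dots> = inv\<^bsub>N\<^esub> el 0 v * (el 0 v * ?P)"
    by (rule assoc_mult_mat[OF N_carrier_mat[OF i(1)] el_carrier_mat[OF assms(1)] P])
  also have "\<dots> \<in> carrier N" using N.m_closed[OF i(1) e] by simp
  finally show ?thesis .
qed

lemma conj_S_mat:
  assumes "v \<in> V"
  shows "conj_N p q M (S_mat c v) \<in> auto N"
    and "R \<in> carrier N \<Longrightarrow> conj_N p q M (S_mat c v) R = S_mat c v * R * S_inv c v"
  using conj_N_auto[OF S_mat_carrier S_inv_carrier S_mat_inverse S_conj_closed] assms by blast+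

lemma S_mat_mult:
  assumes "v \<in> V" "w \<in> V"
  shows "S_mat c v * S_mat d w = S_mat (c + d) (v + J ^\<^sub>m c *\<^sub>v w)"
proof -
  have "- (J ^\<^sub>m c *\<^sub>v w) + - v = - (v + J ^\<^sub>m c *\<^sub>v w)"
    using assms carrier_vecD[OF mat_vec_closed[OF J_pow_carrier[of c] assms(2)]] carrier_vecD[OF assms(1)]
    by (intro eq_vecI) simp_all
  then show ?thesis unfolding S_mat_def using assms
    by (simp add: blk_mult[of _ p] J_pow_add mat_vec_uminus)
qed

lemma conj_S_mat_mult:
  assumes v: "v \<in> V" and w: "w \<in> V"
  shows "conj_N p q M (S_mat c v) \<otimes>\<^bsub>AutoGroup N\<^esub> conj_N p q M (S_mat d w)
    = conj_N p q M (S_mat (c + d) (v + J ^\<^sub>m c *\<^sub>v w))" (is "?l = ?r")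
proof -
  let ?u = "v + J ^\<^sub>m c *\<^sub>v w"
  note cS = S_mat_carrier S_inv_carrier
  note assoc = assoc_mult_mat[of _ "p + 1" "p + 1" _ "p + 1" _ "p + 1"]
  note mc = mult_carrier_mat[of _ "p + 1" "p + 1" _ "p + 1"]
  have u: "?u \<in> V" using v w by simp
  have inv: "S_inv (c + d) ?u = S_inv d w * S_inv c v"
  proof -
    have "S_inv (c + d) ?u * (S_mat (c + d) ?u * (S_inv d w * S_inv c v))
        = S_inv (c + d) ?u * (S_mat c v * (S_mat d w * S_inv d w) * S_inv c v)"
      unfolding S_mat_mult[OF v w, symmetric] using v w u by (simp only: assoc mc cS)
    also have "S_mat c v * (S_mat d w * S_inv d w) * S_inv c v = 1\<^sub>m (p + 1)"
      unfolding S_mat_inverse(1)[OF w] right_mult_one_mat[OF S_mat_carrier[OF v]] by (rule S_mat_inverse(1)[OF v])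
    finally have "S_inv (c + d) ?u * S_mat (c + d) ?u * (S_inv d w * S_inv c v) = S_inv (c + d) ?u * 1\<^sub>m (p + 1)"
      using v w u by (simp only: assoc mc cS)
    then show ?thesis
      unfolding S_mat_inverse(2)[OF u] using v w u by (simp only: mc cS left_mult_one_mat[of _ "p + 1" "p + 1"]
        right_mult_one_mat[of _ "p + 1" "p + 1"])
  qed
  have "?l = compose (carrier N) (conj_N p q M (S_mat c v)) (conj_N p q M (S_mat d w))"
    using conj_S_mat(1) v w by (intro AutoGroup_simps(3))
  also have "\<dots> = ?r"
  proof (rule extensionalityI[of _ "carrier N"])
    show "compose (carrier N) (conj_N p q M (S_mat c v)) (conj_N p q M (S_mat d w)) \<in> extensional (carrier N)"
      by (rule compose_extensional)
    show "?r \<in> extensional (carrier N)" by (simp add: conj_N_def)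
    fix R assume R: "R \<in> carrier N"
    then have Rc: "R \<in> carrier_mat (p + 1) (p + 1)" by (rule N_carrier_mat)
    have "S_mat c v * (S_mat d w * R * S_inv d w) * S_inv c v
        = S_mat (c + d) ?u * R * S_inv (c + d) ?u"
      unfolding inv S_mat_mult[OF v w, symmetric] using v w Rc by (simp only: assoc mc cS)
    then show "compose (carrier N) (conj_N p q M (S_mat c v)) (conj_N p q M (S_mat d w)) R = ?r R"
      using R v w u by (simp add: compose_def conj_S_mat(2) S_conj_closed)
  qed
  finally show ?thesis .
qed

text \<open>The element \<open>g\<^sub>\<eta>\<close> of \<open>G\<close> over \<open>\<eta> = el a v\<close>.\<close>

definition hol_el :: "nat \<Rightarrow> 'p mod_ring vec \<Rightarrow> 'p mod_ring mat \<times> ('p mod_ring mat \<Rightarrow> 'p mod_ring mat)" where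
  "hol_el a v = (el a v, conj_N p q M (S_mat (lastc v) v))"

lemma hol_el_carrier: "v \<in> V \<Longrightarrow> hol_el a v \<in> carrier (Hol N)"
  by (simp add: hol_el_def conj_S_mat)

lemma hol_el_cong: "[a = b] (mod q) \<Longrightarrow> hol_el a v = hol_el b v"
  by (simp add: hol_el_def el_cong)

text \<open>Powers of \<open>J\<close> preserve the last coordinate, so last coordinates add up
  modulo \<open>p\<close>. Hence the exponent of \<open>J\<close> in the composed conjugation is
  again the one prescribed by the new vector.\<close>

lemma hol_el_mult:
  assumes "v \<in> V" "w \<in> V"
  shows "hol_el a v \<otimes>\<^bsub>Hol N\<^esub> hol_el b w = hol_el (a + p ^ lastc v * b) (v + J ^\<^sub>m lastc v *\<^sub>v w)"
proof -
  let ?u = "v + J ^\<^sub>m lastc v *\<^sub>v w"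
  have "[lastc ?u = lastc v + lastc w] (mod p)"
    using assms by (intro lastc_congI) (simp only: add_last mat_vec_closed J_pow_carrier J_pow_last of_nat_add of_nat_lastc)
  then have "S_mat (lastc ?u) ?u = S_mat (lastc v + lastc w) ?u"
    unfolding S_mat_def using J_pow_cong by simp
  then show ?thesis
    using assms by (simp add: hol_el_def conj_S_mat(2) conj_S_mat_mult el_mult_S_conj)
qed

lemma mat_vec_zero [simp]: "A \<in> Mat \<Longrightarrow> A *\<^sub>v 0\<^sub>v p = 0\<^sub>v p"
  by (rule eq_vecI) auto

lemma lastc_0: "v $ (p - 1) = 0 \<Longrightarrow> lastc v = 0"
  unfolding lastc_def by (rule Least_equality) simp_all

lemma lastc_1: "v $ (p - 1) = 1 \<Longrightarrow> lastc v = 1"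
  unfolding lastc_def
proof (rule Least_equality)
  fix i assume v: "v $ (p - 1) = 1" and "of_nat i = v $ (p - 1)"
  then show "1 \<le> i" by (cases i) simp_all
qed simp

lemma S_mat_0: "S_mat 0 v = blk (1\<^sub>m p) (- v)"
  by (simp add: S_mat_def)

lemma X_elem_eq: "X_elem p q M = hol_el 1 (0\<^sub>v p)"
proof -
  have "- 0\<^sub>v p = (0\<^sub>v p :: 'p mod_ring vec)" by (intro eq_vecI) simp_all
  moreover have "lastc (0\<^sub>v p) = 0" using p_gt_0 by (intro lastc_0) simp
  ultimately show ?thesis by (simp add: X_elem_def hol_el_def el_def S_mat_0)
qed

lemma Y_elem_eq: "v \<in> V \<Longrightarrow> v $ (p - 1) = 0 \<Longrightarrow> Y_elem p q M v = hol_el 0 v"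
  by (simp add: Y_elem_def hol_el_def el_def S_mat_0 lastc_0)

lemma Z_elem_eq: "Z_elem p q M = hol_el 0 (unit_vec p (p - 1))"
proof -
  have "lastc (unit_vec p (p - 1)) = 1" using p_gt_0 by (intro lastc_1) simp
  then show ?thesis by (simp add: Z_elem_def hol_el_def el_def S_mat_def)
qed

lemma hol_one: "\<one>\<^bsub>Hol N\<^esub> = hol_el 0 (0\<^sub>v p)"
proof -
  have z: "- 0\<^sub>v p = (0\<^sub>v p :: 'p mod_ring vec)" by (intro eq_vecI) simp_all
  have l: "lastc (0\<^sub>v p) = 0" using p_gt_0 by (intro lastc_0) simp
  have "conj_N p q M (S_mat 0 (0\<^sub>v p)) = (\<lambda>x\<in>carrier N. x)"
  proof (rule extensionalityI[of _ "carrier N"])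
    show "conj_N p q M (S_mat 0 (0\<^sub>v p)) \<in> extensional (carrier N)" by (simp add: conj_N_def)
    fix R assume R: "R \<in> carrier N"
    have "S_mat 0 (0\<^sub>v p) = 1\<^sub>m (p + 1)" "S_inv 0 (0\<^sub>v p) = 1\<^sub>m (p + 1)"
      using blk_one[of p, where 'a = "'p mod_ring"] by (simp_all add: S_mat_def S_inv_def z)
    then have "conj_N p q M (S_mat 0 (0\<^sub>v p)) R = 1\<^sub>m (p + 1) * R * 1\<^sub>m (p + 1)"
      using conj_S_mat(2)[OF zero_carrier_vec R, of 0] by metis
    also have "\<dots> = R" using N_carrier_mat[OF R] by simp
    finally show "conj_N p q M (S_mat 0 (0\<^sub>v p)) R = (\<lambda>x\<in>carrier N. x) R" using R by simp
  qed simp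
  then show ?thesis by (simp add: hol_el_def l el_0_0 AutoGroup_simps(2))
qed

definition hol_set :: "('p mod_ring mat \<times> ('p mod_ring mat \<Rightarrow> 'p mod_ring mat)) set" where
  "hol_set = {hol_el a v | a v. v \<in> V}"

lemma hol_el_in_set [simp]: "v \<in> V \<Longrightarrow> hol_el a v \<in> hol_set"
  by (auto simp: hol_set_def)

lemma subgroup_hol_set: "subgroup hol_set (Hol N)"
proof -
  interpret H: group "Hol N" by (rule group_Hol[OF group_N])
  show ?thesis
  proof (rule H.subgroupI)
    show "hol_set \<subseteq> carrier (Hol N)" by (auto simp: hol_set_def hol_el_carrier simp del: Hol_simps)
    show "hol_set \<noteq> {}" using hol_el_in_set[OF zero_carrier_vec, of 0] by blast
    fix x assume "x \<in> hol_set"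
    then obtain a v where x: "x = hol_el a v" and v: "v \<in> V" by (auto simp: hol_set_def)
    show "x \<otimes>\<^bsub>Hol N\<^esub> y \<in> hol_set" if y: "y \<in> hol_set" for y
    proof -
      obtain b w where "y = hol_el b w" "w \<in> V" using y by (auto simp: hol_set_def)
      then show ?thesis using v by (simp only: x hol_el_mult hol_el_in_set mat_intros)
    qed
    \<comment> \<open>The inverse of (a, v) for the circle product is (-p^(-c) a, -J^(-c) v). The
      number \<open>d\<close> stands for -c modulo \<open>p\<close>, and the factor
      \<open>q - 1\<close> in \<open>b\<close> supplies the sign modulo \<open>q\<close>.\<close>
    define c where "c = lastc v"
    define d where "d = (p - 1) * c"
    define w where "w = J ^\<^sub>m d *\<^sub>v (- v)"
    define b where "b = (q - 1) * (p ^ d * a)"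
    have w: "w \<in> V" unfolding w_def using v by (intro mat_intros)
    have "J ^\<^sub>m c *\<^sub>v w = (J ^\<^sub>m c * J ^\<^sub>m d) *\<^sub>v (- v)"
      unfolding w_def using v by (intro mat_vec_assoc[symmetric] mat_intros)
    also have "\<dots> = - v" unfolding d_def J_pow_inverse using v by simp
    finally have vw: "v + J ^\<^sub>m c *\<^sub>v w = 0\<^sub>v p" using v by (simp add: vec_minus_self)
    have "[p ^ (c + d) = 1] (mod q)"
      using cong_power_one_iff_dvd[OF p q q_dvd] pred_mult_add[OF p_gt_0, of c] by (simp add: d_def add.commute)
    then have "[a + (q - 1) * a * p ^ (c + d) = a + (q - 1) * a * 1] (mod q)"
      by (intro cong_add cong_mult) simp_all
    also have "a + (q - 1) * a * 1 = q * a" using pred_mult_add[OF q_gt_0, of a] by simp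
    also have "[q * a = 0] (mod q)" by (simp add: cong_def)
    finally have ab: "[a + p ^ c * b = 0] (mod q)" by (simp add: b_def power_add mult_ac)
    have "x \<otimes>\<^bsub>Hol N\<^esub> hol_el b w = hol_el (a + p ^ c * b) (0\<^sub>v p)"
      unfolding x using v w vw by (simp add: hol_el_mult c_def)
    also have "\<dots> = \<one>\<^bsub>Hol N\<^esub>" unfolding hol_one by (rule hol_el_cong[OF ab])
    finally have "inv\<^bsub>Hol N\<^esub> x = hol_el b w"
      using H.inv_unique'[of x "hol_el b w"] hol_el_carrier v w x H.inv_equality
      by (metis H.inv_comm)
    then show "inv\<^bsub>Hol N\<^esub> x \<in> hol_set" using w by simp
  qed
qed

lemma last_unit_vec_pred: "unit_vec p (p - 2) $ (p - 1) = (0 :: 'p mod_ring)"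
  using p_gt_1 by simp

lemma G_subset: "G_subgroup p q M \<subseteq> hol_set"
proof -
  interpret H: group "Hol N" by (rule group_Hol[OF group_N])
  show ?thesis unfolding G_subgroup_def
  proof (rule H.generate_subgroup_incl[OF _ subgroup_hol_set])
    show "{X_elem p q M, Y_elem p q M (unit_vec p (p - 2)), Z_elem p q M} \<subseteq> hol_set"
      unfolding X_elem_eq Z_elem_eq Y_elem_eq[OF unit_vec_carrier last_unit_vec_pred] by simp
  qed
qed

lemma subgroup_G: "subgroup (G_subgroup p q M) (Hol N)"
proof -
  interpret H: group "Hol N" by (rule group_Hol[OF group_N])
  have "{X_elem p q M, Y_elem p q M (unit_vec p (p - 2)), Z_elem p q M} \<subseteq> carrier (Hol N)"
    unfolding X_elem_eq Z_elem_eq Y_elem_eq[OF unit_vec_carrier last_unit_vec_pred]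
    using hol_el_carrier by (simp del: Hol_simps)
  then show ?thesis unfolding G_subgroup_def by (rule H.generate_is_subgroup)
qed

lemma G_mult:
  "hol_el a v \<in> G_subgroup p q M \<Longrightarrow> hol_el b w \<in> G_subgroup p q M \<Longrightarrow> v \<in> V \<Longrightarrow> w \<in> V \<Longrightarrow>
    hol_el (a + p ^ lastc v * b) (v + J ^\<^sub>m lastc v *\<^sub>v w) \<in> G_subgroup p q M"
  using subgroup.m_closed[OF subgroup_G] by (simp flip: hol_el_mult)

text \<open>To see that \<open>G\<close> contains everything over \<open>V\<close>: conjugation by \<open>Z\<close> acts on the
  translations in \<open>G\<close> as \<open>J\<close>, and \<open>J - 1\<close> moves \<open>e\<^bsub>p-1\<^esub>\<close> down through the basis.\<close>

abbreviation L :: "'p mod_ring vec set" where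
  "L \<equiv> {v \<in> V. v $ (p - 1) = 0 \<and> hol_el 0 v \<in> G_subgroup p q M}"

lemma L_add:
  assumes "v \<in> L" "w \<in> L"
  shows "v + w \<in> L"
  using assms G_mult[of 0 v 0 w] add_last[of v w] by (simp add: lastc_0)

lemma L_0: "0\<^sub>v p \<in> L"
  using subgroup.one_closed[OF subgroup_G] p_gt_0 unfolding hol_one by simp

lemma of_nat_smult_Suc: "v \<in> V \<Longrightarrow> of_nat (Suc k) \<cdot>\<^sub>v v = of_nat k \<cdot>\<^sub>v v + v"
  by (intro eq_vecI) (auto simp: algebra_simps)

text \<open>Every scalar of the prime field is some \<open>of_nat k\<close>, so closure under
  addition is enough.\<close>

lemma L_smult: "v \<in> L \<Longrightarrow> a \<cdot>\<^sub>v v \<in> L"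
proof -
  assume v: "v \<in> L"
  have "of_nat k \<cdot>\<^sub>v v \<in> L" for k
  proof (induct k)
    case 0
    have "of_nat 0 \<cdot>\<^sub>v v = 0\<^sub>v p" using v by (intro eq_vecI) auto
    then show ?case using L_0 by simp
  next
    case (Suc k)
    then show ?case using L_add[OF Suc v] v by (simp only: of_nat_smult_Suc mem_Collect_eq)
  qed
  moreover obtain k where "a = of_nat k" using surj_of_nat_mod_ring[of a] by blast
  ultimately show "a \<cdot>\<^sub>v v \<in> L" by blast
qed

lemma Z_in_G: "hol_el 0 (unit_vec p (p - 1)) \<in> G_subgroup p q M"
  unfolding G_subgroup_def Z_elem_eq[symmetric] by (rule generate.incl) simp

lemma L_J:
  assumes v: "v \<in> L"
  shows "J *\<^sub>v v \<in> L"
proof -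
  interpret H: group "Hol N" by (rule group_Hol[OF group_N])
  let ?e = "unit_vec p (p - 1) :: 'p mod_ring vec" and ?G = "G_subgroup p q M"
  have e: "?e \<in> V" and v': "v \<in> V" "J *\<^sub>v v \<in> V" using v by auto
  have le: "lastc ?e = 1" using p_gt_0 by (intro lastc_1) simp
  have Jl: "(J *\<^sub>v v) $ (p - 1) = 0" using J_pow_last[of v 1] v by simp
  have c: "hol_el 0 w \<in> carrier (Hol N)" if "w \<in> V" for w by (rule hol_el_carrier[OF that])
  \<comment> \<open>The left factor over \<open>?e\<close> has \<open>lastc\<close> equal to 1 and
    applies \<open>J\<close> to \<open>v\<close>. In the opposite order the left factor
    \<open>J *\<^sub>v v\<close> has last coordinate 0 and leaves \<open>?e\<close> alone, so both
    products lie over the same vector.\<close>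
  have "hol_el 0 ?e \<otimes>\<^bsub>Hol N\<^esub> hol_el 0 v = hol_el 0 (?e + J *\<^sub>v v)"
    using hol_el_mult[OF e v'(1), of 0 0] by (simp add: le[simplified])
  also have "\<dots> = hol_el 0 (J *\<^sub>v v) \<otimes>\<^bsub>Hol N\<^esub> hol_el 0 ?e"
    using hol_el_mult[OF v'(2) e, of 0 0] e v' by (simp add: lastc_0[OF Jl] comm_add_vec[of _ p])
  finally have "hol_el 0 (J *\<^sub>v v) = hol_el 0 ?e \<otimes>\<^bsub>Hol N\<^esub> hol_el 0 v \<otimes>\<^bsub>Hol N\<^esub> inv\<^bsub>Hol N\<^esub> hol_el 0 ?e"
    using H.inv_solve_right c e v' by (metis H.m_closed)
  also have "\<dots> \<in> ?G"
    using Z_in_G v by (intro subgroup.m_closed[OF subgroup_G] subgroup.m_inv_closed[OF subgroup_G]) simp_all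
  finally show ?thesis using v' Jl by simp
qed

lemma L_unit_vec: "i < p - 1 \<Longrightarrow> unit_vec p (p - 2 - i) \<in> L"
proof (induct i)
  case 0
  have "hol_el 0 (unit_vec p (p - 2)) \<in> G_subgroup p q M"
    unfolding G_subgroup_def Y_elem_eq[OF unit_vec_carrier last_unit_vec_pred, symmetric]
    by (rule generate.incl) simp
  then show ?case using last_unit_vec_pred by simp
next
  case (Suc i)
  let ?k = "p - 2 - i"
  let ?e = "unit_vec p ?k :: 'p mod_ring vec"
  have e: "?e \<in> L" using Suc by simp
  have "J *\<^sub>v ?e + (-1) \<cdot>\<^sub>v ?e = unit_vec p (p - 2 - Suc i)"
    unfolding jordan_block_1_mult_vec[OF unit_vec_carrier]
    using Suc(2) by (intro eq_vecI) (auto simp: index_shift_vec[of _ p] unit_vec_def shift_vec_def)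
  moreover have "J *\<^sub>v ?e + (-1) \<cdot>\<^sub>v ?e \<in> L" using L_add[OF L_J[OF e] L_smult[OF e]] .
  ultimately show ?case by metis
qed

lemma L_all:
  assumes v: "v \<in> V" and "v $ (p - 1) = 0"
  shows "v \<in> L"
proof -
  have "vec p (\<lambda>i. if i < k then v $ i else 0) \<in> L" if "k < p" for k
    using that
  proof (induct k)
    case 0
    have "vec p (\<lambda>i. if i < 0 then v $ i else 0) = 0\<^sub>v p" by (intro eq_vecI) auto
    then show ?case using L_0 by metis
  next
    case (Suc k)
    have eq: "vec p (\<lambda>i. if i < Suc k then v $ i else 0) = vec p (\<lambda>i. if i < k then v $ i else 0) + v $ k \<cdot>\<^sub>v unit_vec p k"
      using Suc(2) by (intro eq_vecI) (auto simp: less_Suc_eq)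
    have e: "unit_vec p k \<in> L"
    proof -
      have "p - 2 - (p - 2 - k) = k" "p - 2 - k < p - 1" using Suc(2) by auto
      then show ?thesis using L_unit_vec[of "p - 2 - k"] by metis
    qed
    show ?case unfolding eq by (rule L_add[OF Suc(1) L_smult[OF e]]) (use Suc(2) in simp)
  qed
  from this[of "p - 1"] have "vec p (\<lambda>i. if i < p - 1 then v $ i else 0) \<in> L" using p_gt_0 by simp
  moreover have "vec p (\<lambda>i. if i < p - 1 then v $ i else 0) = v"
  proof (intro eq_vecI)
    fix i assume i: "i < dim_vec v"
    then have "i < p" using v by simp
    then have "i = p - 1 \<or> i < p - 1" by auto
    then show "vec p (\<lambda>i. if i < p - 1 then v $ i else 0) $ i = v $ i" using assms(2) \<open>i < p\<close> by auto
  qed (use v in simp)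
  ultimately show ?thesis by metis
qed

text \<open>Multiplying on the left by \<open>Z\<close> raises the last coordinate by 1.\<close>

lemma hol_el_last:
  "\<exists>u\<in>V. u $ (p - 1) = of_nat c \<and> hol_el 0 u \<in> G_subgroup p q M"
proof (induct c)
  case 0
  show ?case using L_0 by (intro bexI[of _ "0\<^sub>v p"]) auto
next
  case (Suc c)
  then obtain u where u: "u \<in> V" "u $ (p - 1) = of_nat c" "hol_el 0 u \<in> G_subgroup p q M" by blast
  let ?e = "unit_vec p (p - 1) :: 'p mod_ring vec"
  have le: "lastc ?e = 1" using p_gt_0 by (intro lastc_1) simp
  have "hol_el 0 (?e + J *\<^sub>v u) \<in> G_subgroup p q M"
    using G_mult[OF Z_in_G u(3)] u(1) by (simp add: le[simplified])
  moreover have "(?e + J *\<^sub>v u) $ (p - 1) = of_nat (Suc c)"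
    using u J_pow_last[of u 1] add_last[of ?e "J *\<^sub>v u"] p_gt_0 by simp
  ultimately show ?case using u(1) by (intro bexI[of _ "?e + J *\<^sub>v u"]) simp_all
qed

text \<open>Subtracting from \<open>v\<close> a vector \<open>u\<close> over which \<open>G\<close>
  has an element, with the same last coordinate, leaves a vector of \<open>L\<close>. As a left
  factor it does not twist \<open>u\<close>, so the product lies over \<open>v\<close>.\<close>

lemma hol_el_0_in_G:
  assumes v: "v \<in> V"
  shows "hol_el 0 v \<in> G_subgroup p q M"
proof -
  obtain u where u: "u \<in> V" "u $ (p - 1) = of_nat (lastc v)" "hol_el 0 u \<in> G_subgroup p q M"
    using hol_el_last by blast
  have w: "v - u \<in> L"
    using v u p_gt_0 by (intro L_all) (auto simp: of_nat_lastc)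
  then have "hol_el 0 (v - u + u) \<in> G_subgroup p q M"
    using G_mult[of 0 "v - u" 0 u] u by (simp add: lastc_0)
  moreover have "v - u + u = v" using v u(1) by (intro eq_vecI) auto
  ultimately show ?thesis by simp
qed

lemma hol_el_in_G:
  assumes v: "v \<in> V"
  shows "hol_el a v \<in> G_subgroup p q M"
proof -
  have l0: "lastc (0\<^sub>v p) = 0" using p_gt_0 by (intro lastc_0) simp
  have X1: "hol_el 1 (0\<^sub>v p) \<in> G_subgroup p q M"
    unfolding G_subgroup_def X_elem_eq[symmetric] by (rule generate.incl) simp
  show ?thesis
  proof (induct a)
    case 0
    show ?case by (rule hol_el_0_in_G[OF v])
  next
    case (Suc a)
    then show ?case using G_mult[OF X1 Suc] v by (simp add: l0)
  qed
qed

lemma G_eq: "G_subgroup p q M = hol_set"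
  using G_subset hol_el_in_G by (auto simp: hol_set_def)

section \<open>The circle operation in coordinates\<close>

lemma elem_over_el:
  assumes v: "v \<in> V"
  shows "elem_over (G_subgroup p q M) (el a v) = hol_el a v"
  unfolding elem_over_def G_eq
proof (rule the_equality)
  show "hol_el a v \<in> hol_set \<and> fst (hol_el a v) = el a v"
    using hol_el_in_set[OF v] by (auto simp: hol_el_def)
  fix g assume g: "g \<in> hol_set \<and> fst g = el a v"
  then obtain b w where "g = hol_el b w" "w \<in> V" by (auto simp: hol_set_def)
  then show "g = hol_el a v"
    using g v by (metis hol_el_cong el_eq_iff hol_el_def fst_conv)
qed

abbreviation B :: "'p mod_ring mat monoid" where "B \<equiv> B_circ p q M"

lemma carrier_B [simp]: "carrier B = carrier N"
  by (simp add: B_circ_def)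

lemma circ_el:
  assumes "v \<in> V" "w \<in> V"
  shows "el a v \<otimes>\<^bsub>B\<^esub> el b w = el (a + p ^ lastc v * b) (v + J ^\<^sub>m lastc v *\<^sub>v w)"
proof -
  have "el a v \<otimes>\<^bsub>B\<^esub> el b w = fst (hol_el a v \<otimes>\<^bsub>Hol N\<^esub> hol_el b w)"
    using assms by (simp add: B_circ_def circ_group_def elem_over_el)
  then show ?thesis using assms by (simp only: hol_el_mult) (simp add: hol_el_def)
qed

section \<open>Irreducibility of \<open>M\<close>\<close>

lemma p_pow_p_cong: "[p ^ p = 1] (mod q)"
  using cong_power_one_iff_dvd[OF p q q_dvd] by simp

lemma q_not_dvd_p_pow: "\<not> q dvd p ^ c"
proof
  assume "q dvd p ^ c"
  then have "q dvd p" using q prime_dvd_power by blast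
  then have "q dvd p ^ p" using p_gt_0 dvd_power[of p p] dvd_trans by blast
  then have "q dvd 1" using p_pow_p_cong cong_dvd_iff by blast
  then show False using q_gt_1 by simp
qed

lemma cong_cancel: "\<not> q dvd a \<Longrightarrow> [a * b = a * c] (mod q) \<Longrightarrow> [b = c] (mod q)"
  using cong_mult_lcancel_nat[of a q b c] prime_imp_coprime[OF q, of a]
    algebraic_semidom_class.coprime_commute[of q a] by simp

lemma p_pow_cong_iff: "[p ^ c = p ^ d] (mod q) \<longleftrightarrow> [c = d] (mod p)"
proof
  have *: "[c = d] (mod p)" if "[p ^ c = p ^ d] (mod q)" "c \<le> d" for c d
  proof -
    have "[p ^ c * p ^ (d - c) = p ^ c * 1] (mod q)"
      using that by (simp add: cong_sym_eq flip: power_add)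
    then have "[p ^ (d - c) = 1] (mod q)" by (rule cong_cancel[OF q_not_dvd_p_pow])
    then have "p dvd d - c" using cong_power_one_iff_dvd[OF p q q_dvd] by simp
    then have "[d = c] (mod p)" using that(2) by (simp add: cong_altdef_nat)
    then show ?thesis by (rule cong_sym)
  qed
  assume "[p ^ c = p ^ d] (mod q)"
  then show "[c = d] (mod p)" using *[of c d] *[of d c] by (cases "c \<le> d") (auto simp: cong_sym_eq)
qed (rule p_pow_cong)

text \<open>\<open>p\<close> is invertible modulo \<open>q\<close>, so the two primes
  differ.\<close>

lemma of_nat_q_nonzero: "(of_nat q :: 'p mod_ring) \<noteq> 0"
proof
  assume "(of_nat q :: 'p mod_ring) = 0"
  then have "[q = 0] (mod p)" using of_nat_eq_iff_cong[of q 0] by simp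
  then have "p dvd q" by (simp add: cong_0_iff)
  then have "p = q" using p q primes_dvd_imp_eq by blast
  then show False using q_not_dvd_p_pow[of 1] by simp
qed

text \<open>Additive subgroups of a vector space over a prime field are its subspaces; in this form
  Lagrange's theorem shows that their size is a power of \<open>p\<close>.\<close>

definition vec_subgroup :: "'p mod_ring vec set \<Rightarrow> bool" where
  "vec_subgroup K \<longleftrightarrow> subgroup K (monoid_vec TYPE('p mod_ring) p)"

lemma inv_monoid_vec: "v \<in> V \<Longrightarrow> inv\<^bsub>monoid_vec TYPE('p mod_ring) p\<^esub> v = - v"
  by (rule group.inv_equality[OF comm_group.axioms(2)[OF comm_group_vec]])
    (simp_all add: monoid_vec_simps vec_minus_self)

lemma vec_subgroupI:
  assumes "K \<subseteq> V" "0\<^sub>v p \<in> K" "\<And>v w. v \<in> K \<Longrightarrow> w \<in> K \<Longrightarrow> v + w \<in> K" "\<And>v. v \<in> K \<Longrightarrow> - v \<in> K"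
  shows "vec_subgroup K"
  unfolding vec_subgroup_def
  using assms inv_monoid_vec by (intro subgroup.intro) (auto simp: monoid_vec_simps subset_iff)

lemma card_vec_subgroup:
  assumes "vec_subgroup K"
  obtains d where "d \<le> p" "card K = p ^ d"
proof -
  let ?G = "monoid_vec TYPE('p mod_ring) p"
  have "card V = p ^ p" by (simp add: card_carrier_vec card_p)
  moreover have "card (rcosets\<^bsub>?G\<^esub> K) * card K = Coset.order ?G"
    using assms unfolding vec_subgroup_def
    by (rule group.lagrange[OF comm_group.axioms(2)[OF comm_group_vec]])
  ultimately have "card K dvd p ^ p" by (metis Coset.order_def dvd_triv_right monoid_vec_simps(2))
  then show ?thesis using that divides_primepow_nat[OF p] by blast
qed

lemma M_pow_q_vec: "v \<in> V \<Longrightarrow> (((*\<^sub>v) M) ^^ q) v = v"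
  using pow_mat_mult_vec[OF M_carrier, of v q] M_pow_eq_1_iff[of q] by simp

text \<open>Let p^f be the number of fixed vectors. Then \<open>q\<close> divides p^p - p^f, the
  number of moved vectors, so \<open>p\<close> divides p - f. As \<open>M\<close> is not the
  identity, f < p, and f = 0 remains.\<close>

lemma M_fixed_vec:
  assumes "v \<in> V" "M *\<^sub>v v = v"
  shows "v = 0\<^sub>v p"
proof -
  let ?F = "{v \<in> V. M *\<^sub>v v = v}"
  have F: "vec_subgroup ?F"
    by (rule vec_subgroupI) (auto simp: mat_vec_add mat_vec_uminus)
  obtain f where f: "f \<le> p" "card ?F = p ^ f" using card_vec_subgroup[OF F] .
  have "f \<noteq> p"
  proof
    assume "f = p"
    then have "?F = V"
      using f by (intro card_subset_eq) (auto simp: card_carrier_vec card_p)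
    then have "M *\<^sub>v w = 1\<^sub>m p *\<^sub>v w" if "w \<in> V" for w using that by auto
    then have "M = 1\<^sub>m p" by (intro eq_mat_mult_vecI[of _ p p]) auto
    then have "q dvd 1" using M_pow_eq_1_iff[of 1] by simp
    then show False using q_gt_1 by simp
  qed
  then have fp: "f < p" using f by simp
  have "q dvd card {v \<in> V. M *\<^sub>v v \<noteq> v}"
    by (rule prime_dvd_card_nonfixed[OF _ q]) (auto simp: M_pow_q_vec)
  also have "{v \<in> V. M *\<^sub>v v \<noteq> v} = V - ?F" by auto
  also have "card \<dots> = p ^ p - p ^ f"
    by (subst card_Diff_subset) (auto simp: f card_carrier_vec card_p intro: finite_subset[of _ V])
  also have "\<dots> = p ^ f * (p ^ (p - f) - 1)"
    using fp by (simp add: diff_mult_distrib2 flip: power_add)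
  finally have "q dvd p ^ (p - f) - 1" using q_not_dvd_p_pow q prime_dvd_multD by blast
  then have "[p ^ (p - f) = 1] (mod q)" using p_gt_0 by (simp add: cong_altdef_nat)
  then have "p dvd p - f" using cong_power_one_iff_dvd[OF p q q_dvd] by simp
  then have "f = 0" using fp by (auto dest: dvd_imp_le)
  then have "card ?F = 1" using f by simp
  moreover have "0\<^sub>v p \<in> ?F" "v \<in> ?F" using assms by auto
  ultimately show ?thesis by (metis card_1_singletonE singletonD)
qed

text \<open>\<open>M\<close> moves every nonzero vector of \<open>K\<close>, so \<open>q\<close>
  divides p^d - 1 for the size p^d of \<open>K\<close>. Hence \<open>p\<close> divides d, and 0 < d
  <= p forces d = p.\<close>

lemma M_irreducible:
  assumes K: "vec_subgroup K" and inv: "\<And>v. v \<in> K \<Longrightarrow> M *\<^sub>v v \<in> K"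
    and u: "u \<in> K" "u \<noteq> 0\<^sub>v p"
  shows "K = V"
proof -
  have KV: "K \<subseteq> V" and K0: "0\<^sub>v p \<in> K"
    using subgroup.subset[OF K[unfolded vec_subgroup_def]] subgroup.one_closed[OF K[unfolded vec_subgroup_def]]
    by (simp_all add: monoid_vec_simps)
  have fin: "finite K" using KV by (rule finite_subset) simp
  obtain d where d: "d \<le> p" "card K = p ^ d" using card_vec_subgroup[OF K] .
  have "q dvd card {v \<in> K. M *\<^sub>v v \<noteq> v}"
    by (rule prime_dvd_card_nonfixed[OF fin q]) (use inv KV M_pow_q_vec in auto)
  also have "{v \<in> K. M *\<^sub>v v \<noteq> v} = K - {0\<^sub>v p}"
    using KV M_fixed_vec by auto
  also have "card \<dots> = p ^ d - 1" using K0 d by simp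
  finally have "[p ^ d = 1] (mod q)" using p_gt_0 by (simp add: cong_altdef_nat)
  then have "p dvd d" using cong_power_one_iff_dvd[OF p q q_dvd] by simp
  moreover have "d \<noteq> 0"
  proof
    assume "d = 0"
    then have "card K = 1" using d by simp
    then show False using K0 u by (metis card_1_singletonE singletonD)
  qed
  ultimately have "d = p" using d by (auto dest: dvd_imp_le)
  then show ?thesis using KV d by (intro card_subset_eq) (auto simp: card_carrier_vec card_p)
qed

section \<open>Automorphisms of the skew brace\<close>

text \<open>\<open>S_mat j (0\<^sub>v p)\<close> is the block matrix of \<open>J ^\<^sub>m j\<close>
  with zero translation part, so these are the powers of the automorphism named in the
  theorem.\<close>

definition sigma :: "nat \<Rightarrow> 'p mod_ring mat \<Rightarrow> 'p mod_ring mat" where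
  "sigma j = conj_N p q M (S_mat j (0\<^sub>v p))"

lemma sigma_auto: "sigma j \<in> auto N"
  unfolding sigma_def by (rule conj_S_mat) simp

lemma sigma_el:
  assumes w: "w \<in> V"
  shows "sigma j (el b w) = el (p ^ j * b) (J ^\<^sub>m j *\<^sub>v w)"
proof -
  let ?R = "S_mat j (0\<^sub>v p) * el b w * S_inv j (0\<^sub>v p)"
  have R: "?R \<in> carrier N" using w by (intro S_conj_closed) simp_all
  have "sigma j (el b w) = el 0 (0\<^sub>v p) * ?R"
    unfolding sigma_def el_0_0 using conj_S_mat(2)[OF zero_carrier_vec el_in_N[OF w]]
      left_mult_one_mat[OF N_carrier_mat[OF R]] by metis
  also have "\<dots> = el (0 + p ^ j * b) (0\<^sub>v p + J ^\<^sub>m j *\<^sub>v w)"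
    using w by (intro el_mult_S_conj) simp_all
  also have "0\<^sub>v p + J ^\<^sub>m j *\<^sub>v w = J ^\<^sub>m j *\<^sub>v w"
    using w by (intro left_zero_vec mat_intros)
  finally show ?thesis by simp
qed

lemma sigma_mult: "sigma i \<otimes>\<^bsub>AutoGroup N\<^esub> sigma j = sigma (i + j)"
  unfolding sigma_def by (subst conj_S_mat_mult) simp_all

lemma sigma_cong: "[i = j] (mod p) \<Longrightarrow> sigma i = sigma j"
  using J_pow_cong unfolding sigma_def S_mat_def by metis

lemma sigma_0: "sigma 0 = \<one>\<^bsub>AutoGroup N\<^esub>"
proof -
  have "lastc (0\<^sub>v p) = 0" using p_gt_0 by (intro lastc_0) simp
  then show ?thesis using hol_one by (simp add: hol_el_def sigma_def)
qed

lemma sigma_1: "sigma 1 = conj_N p q M (blk J (0\<^sub>v p))"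
proof -
  have "- 0\<^sub>v p = (0\<^sub>v p :: 'p mod_ring vec)" by (intro eq_vecI) simp_all
  then show ?thesis by (simp add: sigma_def S_mat_def)
qed

lemma sigma_inj:
  assumes "sigma i = sigma j"
  shows "[i = j] (mod p)"
proof -
  have "el (p ^ i * 1) (0\<^sub>v p) = el (p ^ j * 1) (0\<^sub>v p)"
    using sigma_el[of "0\<^sub>v p" i 1] sigma_el[of "0\<^sub>v p" j 1] assms by simp
  then show ?thesis by (simp add: el_eq_iff p_pow_cong_iff)
qed

text \<open>Powers of \<open>J\<close> commute with each other and preserve the last coordinate, so
  \<open>v\<close> and its image twist the right factor by the same power.\<close>

lemma sigma_auto_B: "sigma j \<in> auto B"
proof -
  have "sigma j \<in> hom B B"
  proof (rule homI)
    fix x y assume x: "x \<in> carrier B" and y: "y \<in> carrier B"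
    then show "sigma j x \<in> carrier B" using auto_closed[OF sigma_auto] by simp
    obtain a v b w where xy: "x = el a v" "y = el b w" and v: "v \<in> V" and w: "w \<in> V"
      using x y by (auto simp: carrier_N)
    have l: "lastc (J ^\<^sub>m j *\<^sub>v v) = lastc v" unfolding lastc_def using v by (simp only: J_pow_last)
    let ?c = "lastc v"
    have vJ: "J ^\<^sub>m j *\<^sub>v v \<in> V" "J ^\<^sub>m j *\<^sub>v w \<in> V" "J ^\<^sub>m ?c *\<^sub>v w \<in> V" using v w by (simp_all only: mat_intros)
    have "sigma j (x \<otimes>\<^bsub>B\<^esub> y) = el (p ^ j * (a + p ^ ?c * b)) (J ^\<^sub>m j *\<^sub>v (v + J ^\<^sub>m ?c *\<^sub>v w))"
      unfolding xy circ_el[OF v w] using v w by (intro sigma_el mat_intros)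
    also have "J ^\<^sub>m j *\<^sub>v (v + J ^\<^sub>m ?c *\<^sub>v w) = J ^\<^sub>m j *\<^sub>v v + J ^\<^sub>m (j + ?c) *\<^sub>v w"
      using v w vJ by (simp only: mat_vec_add J_pow_carrier J_pow_add_vec)
    also have "J ^\<^sub>m (j + ?c) *\<^sub>v w = J ^\<^sub>m ?c *\<^sub>v (J ^\<^sub>m j *\<^sub>v w)"
      using w by (simp only: add.commute[of j] J_pow_add_vec)
    also have "p ^ j * (a + p ^ ?c * b) = p ^ j * a + p ^ ?c * (p ^ j * b)"
      by (simp add: algebra_simps)
    also have "el (p ^ j * a + p ^ ?c * (p ^ j * b)) (J ^\<^sub>m j *\<^sub>v v + J ^\<^sub>m ?c *\<^sub>v (J ^\<^sub>m j *\<^sub>v w))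
        = sigma j x \<otimes>\<^bsub>B\<^esub> sigma j y"
      unfolding xy sigma_el[OF v] sigma_el[OF w] circ_el[OF vJ(1,2)] l ..
    finally show "sigma j (x \<otimes>\<^bsub>B\<^esub> y) = sigma j x \<otimes>\<^bsub>B\<^esub> sigma j y" .
  qed
  then show ?thesis using sigma_auto[of j] by (simp add: auto_def)
qed

lemma pow_el_0:
  assumes v: "v \<in> V"
  shows "el 0 v [^]\<^bsub>N\<^esub> k = el 0 (of_nat k \<cdot>\<^sub>v v)"
proof (induct k)
  interpret N: group N by (rule group_N)
  case 0
  have "of_nat 0 \<cdot>\<^sub>v v = 0\<^sub>v p" using v by (intro eq_vecI) auto
  then have "el 0 (of_nat 0 \<cdot>\<^sub>v v) = \<one>\<^bsub>N\<^esub>" by (simp only: el_0_0 N_simps)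
  then show ?case by (simp only: N.nat_pow_0)
next
  interpret N: group N by (rule group_N)
  case (Suc k)
  have u: "of_nat k \<cdot>\<^sub>v v \<in> V" using v by simp
  have "el 0 v [^]\<^bsub>N\<^esub> Suc k = el 0 (M ^\<^sub>m 0 *\<^sub>v (of_nat k \<cdot>\<^sub>v v)) * el 0 v"
    using u Suc by simp
  also have "\<dots> = el (0 + 0) (of_nat k \<cdot>\<^sub>v v + v)" by (rule el_mult[OF u v])
  finally show ?case using v by (simp only: of_nat_smult_Suc add_0)
qed

lemma pow_el:
  assumes v: "v \<in> V"
  shows "\<exists>w\<in>V. el a v [^]\<^bsub>N\<^esub> (k :: nat) = el (k * a) w"
proof (induct k)
  interpret N: group N by (rule group_N)
  case 0
  have "el a v [^]\<^bsub>N\<^esub> (0 :: nat) = el (0 * a) (0\<^sub>v p)" using el_0_0 by simp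
  then show ?case by (intro bexI[of _ "0\<^sub>v p"]) simp_all
next
  interpret N: group N by (rule group_N)
  case (Suc k)
  then obtain w where w: "w \<in> V" "el a v [^]\<^bsub>N\<^esub> k = el (k * a) w" by blast
  let ?u = "M ^\<^sub>m ((q - 1) * a) *\<^sub>v w + v"
  have "el a v [^]\<^bsub>N\<^esub> Suc k = el (Suc k * a) ?u"
    using el_mult'[OF w(1) v, of "k * a" a] w(2) by (simp add: add.commute)
  moreover have "?u \<in> V" using w v by (intro mat_intros)
  ultimately show ?case by blast
qed

lemma el_split: "v \<in> V \<Longrightarrow> el a v = el a (0\<^sub>v p) * el 0 v"
  using el_mult[of "0\<^sub>v p" v a 0] by simp

lemma el_0_mult: "v \<in> V \<Longrightarrow> w \<in> V \<Longrightarrow> el 0 v * el 0 w = el 0 (v + w)"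
  using el_mult[of v w 0 0] by simp

lemma el_mult_zero: "v \<in> V \<Longrightarrow> el 0 (M ^\<^sub>m b *\<^sub>v v) * el b (0\<^sub>v p) = el b v"
  using el_mult[of v "0\<^sub>v p" 0 b] by simp

lemma lastc_unit_vec: "lastc (unit_vec p (p - 1)) = 1"
  using p_gt_0 by (intro lastc_1) simp

section \<open>The shape of an arbitrary automorphism of both operations\<close>

context
  fixes \<phi> :: "'p mod_ring mat \<Rightarrow> 'p mod_ring mat"
  assumes phi_N: "\<phi> \<in> auto N" and phi_B: "\<phi> \<in> auto B"
begin

lemma phi_mult: "x \<in> carrier N \<Longrightarrow> y \<in> carrier N \<Longrightarrow> \<phi> (x * y) = \<phi> x * \<phi> y"
  using auto_mult[OF phi_N] by simp

lemma phi_circ: "x \<in> carrier N \<Longrightarrow> y \<in> carrier N \<Longrightarrow> \<phi> (x \<otimes>\<^bsub>B\<^esub> y) = \<phi> x \<otimes>\<^bsub>B\<^esub> \<phi> y"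
  using auto_mult[OF phi_B] by simp

lemma phi_one: "\<phi> (el 0 (0\<^sub>v p)) = el 0 (0\<^sub>v p)"
  unfolding el_0_0 using group.auto_one[OF group_N phi_N] by simp

lemma phi_inj: "x \<in> carrier N \<Longrightarrow> y \<in> carrier N \<Longrightarrow> \<phi> x = \<phi> y \<Longrightarrow> x = y"
  using phi_N by (auto simp: auto_def Bij_def bij_betw_def inj_on_def)

text \<open>The p-th power of \<open>el 0 v\<close> in \<open>N\<close> is trivial, hence so is that
  of its image. For the first coordinate \<open>a\<close> of the image this says p a = 0 modulo
  \<open>q\<close>, and \<open>p\<close> is invertible there.\<close>

lemma phi_el_0:
  assumes v: "v \<in> V"
  shows "\<exists>u\<in>V. \<phi> (el 0 v) = el 0 u"
proof -
  obtain a u where u: "u \<in> V" "\<phi> (el 0 v) = el a u"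
    using auto_closed[OF phi_N el_in_N[OF v, of 0]] by (auto simp: carrier_N)
  have "(of_nat p :: 'p mod_ring) = 0" using of_nat_eq_iff_cong[of p 0] by (simp add: cong_def)
  then have "of_nat p \<cdot>\<^sub>v v = 0\<^sub>v p" using v by (intro eq_vecI) auto
  then have "el 0 v [^]\<^bsub>N\<^esub> p = el 0 (0\<^sub>v p)" using pow_el_0[OF v, of p] by simp
  then have "el 0 (0\<^sub>v p) = \<phi> (el 0 v) [^]\<^bsub>N\<^esub> p"
    using hom_nat_pow[of \<phi> N N "el 0 v" p] phi_N group_N v phi_one by (simp add: auto_def)
  moreover obtain w where "w \<in> V" "el a u [^]\<^bsub>N\<^esub> p = el (p * a) w" using pow_el[OF u(1)] by blast
  ultimately have "[p * a = 0] (mod q)" using u(2) el_eq_iff[of w "0\<^sub>v p" "p * a" 0] by simp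
  then have "q dvd p * a" by (simp add: cong_0_iff)
  then have "q dvd a" using q_not_dvd_p_pow[of 1] q prime_dvd_multD by auto
  then have "el a u = el 0 u" by (intro el_cong) (simp add: cong_0_iff)
  then show ?thesis using u by auto
qed

lemma circ_zero_left: "w \<in> V \<Longrightarrow> el a (0\<^sub>v p) \<otimes>\<^bsub>B\<^esub> el b w = el (a + b) w"
  using circ_el[of "0\<^sub>v p" w a b] lastc_0[of "0\<^sub>v p"] p_gt_0 by simp

text \<open>If \<open>el 1 0\<close> is sent to \<open>el k w\<close>, the last coordinate of the \<open>n\<close>-th circle power of
  \<open>el k w\<close> is \<open>n\<close> times that of \<open>w\<close>. It vanishes for \<open>n = q\<close>, so \<open>w\<close> has last coordinate 0;
  then circle powers of \<open>el k w\<close> are linear in \<open>w\<close> and \<open>q w = 0\<close>.\<close>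

lemma phi_el_1: "\<exists>k. \<phi> (el 1 (0\<^sub>v p)) = el k (0\<^sub>v p)"
proof -
  obtain k w where w: "w \<in> V" and kw: "\<phi> (el 1 (0\<^sub>v p)) = el k w"
    using auto_closed[OF phi_N el_in_N[of "0\<^sub>v p" 1]] by (auto simp: carrier_N)
  have step: "\<phi> (el (Suc n) (0\<^sub>v p)) = \<phi> (el n (0\<^sub>v p)) \<otimes>\<^bsub>B\<^esub> el k w" for n
    using circ_zero_left[of "0\<^sub>v p" n 1] phi_circ[of "el n (0\<^sub>v p)" "el 1 (0\<^sub>v p)"] kw by simp
  have at_q: "\<phi> (el q (0\<^sub>v p)) = el 0 (0\<^sub>v p)"
    using el_cong[of q 0 "0\<^sub>v p"] phi_one by (simp add: cong_def)
  have "\<exists>a u. \<phi> (el n (0\<^sub>v p)) = el a u \<and> u \<in> V \<and> u $ (p - 1) = of_nat n * w $ (p - 1)" for n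
  proof (induct n)
    case 0
    show ?case using phi_one p_gt_0 by (intro exI[of _ 0] exI[of _ "0\<^sub>v p"]) simp
  next
    case (Suc n)
    then obtain a u where u: "\<phi> (el n (0\<^sub>v p)) = el a u" "u \<in> V" "u $ (p - 1) = of_nat n * w $ (p - 1)"
      by blast
    let ?u = "u + J ^\<^sub>m lastc u *\<^sub>v w"
    have "\<phi> (el (Suc n) (0\<^sub>v p)) = el (a + p ^ lastc u * k) ?u"
      unfolding step u(1) by (rule circ_el[OF u(2) w])
    moreover have "?u \<in> V" using u w by (intro mat_intros)
    moreover have "?u $ (p - 1) = of_nat (Suc n) * w $ (p - 1)"
      using add_last[OF u(2) mat_vec_closed[OF J_pow_carrier w]] J_pow_last[OF w] u(3)
      by (simp add: algebra_simps)
    ultimately show ?case by blast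
  qed
  then obtain a u where "\<phi> (el q (0\<^sub>v p)) = el a u" "u \<in> V" "u $ (p - 1) = of_nat q * w $ (p - 1)" by blast
  then have "of_nat q * w $ (p - 1) = 0"
    using at_q el_eq_iff[of u "0\<^sub>v p" a 0] p_gt_0 by simp
  then have w0: "w $ (p - 1) = 0" using of_nat_q_nonzero by simp
  have "\<phi> (el n (0\<^sub>v p)) = el (n * k) (of_nat n \<cdot>\<^sub>v w)" for n
  proof (induct n)
    case 0
    have "of_nat 0 \<cdot>\<^sub>v w = 0\<^sub>v p" using w by (intro eq_vecI) auto
    then show ?case using phi_one by simp
  next
    case (Suc n)
    have u: "of_nat n \<cdot>\<^sub>v w \<in> V" using w by simp
    have l: "lastc (of_nat n \<cdot>\<^sub>v w) = 0" using w w0 p_gt_0 by (intro lastc_0) simp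
    have "\<phi> (el (Suc n) (0\<^sub>v p)) = el (n * k + p ^ 0 * k) (of_nat n \<cdot>\<^sub>v w + J ^\<^sub>m 0 *\<^sub>v w)"
      unfolding step Suc circ_el[OF u w] l ..
    also have "J ^\<^sub>m 0 *\<^sub>v w = w" using w by simp
    also have "of_nat n \<cdot>\<^sub>v w + w = of_nat (Suc n) \<cdot>\<^sub>v w" using w by (simp only: of_nat_smult_Suc)
    finally show ?case by (simp add: add.commute)
  qed
  from this[of q] have qw: "of_nat q \<cdot>\<^sub>v w = 0\<^sub>v p"
    using at_q el_eq_iff[of "of_nat q \<cdot>\<^sub>v w" "0\<^sub>v p" "q * k" 0] w by simp
  have "w = 0\<^sub>v p"
  proof (rule eq_vecI)
    fix i assume i: "i < dim_vec (0\<^sub>v p :: 'p mod_ring vec)"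
    have "(of_nat q \<cdot>\<^sub>v w) $ i = 0\<^sub>v p $ i" by (simp only: qw)
    then show "w $ i = 0\<^sub>v p $ i" using i w of_nat_q_nonzero by simp
  qed (use w in simp)
  then show ?thesis using kw by blast
qed

lemma phi_is_sigma: "\<exists>j<p. \<phi> = sigma j"
proof -
  obtain k where k: "\<phi> (el 1 (0\<^sub>v p)) = el k (0\<^sub>v p)" using phi_el_1 by blast
  have "\<forall>v\<in>V. \<exists>u. u \<in> V \<and> \<phi> (el 0 v) = el 0 u" using phi_el_0 by blast
  then obtain f where f: "\<And>v. v \<in> V \<Longrightarrow> f v \<in> V" "\<And>v. v \<in> V \<Longrightarrow> \<phi> (el 0 v) = el 0 (f v)"
    by (metis bchoice)
  let ?z = "0\<^sub>v p :: 'p mod_ring vec"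
  have a0: "\<phi> (el a ?z) = el (a * k) ?z" for a
  proof (induct a)
    case 0
    show ?case using phi_one by simp
  next
    case (Suc a)
    have "el a ?z * el b ?z = el (a + b) ?z" for a b
      using el_mult[of ?z ?z a b] by simp
    from this[of a 1] this[of "a * k" k] show ?case
      using phi_mult[of "el a ?z" "el 1 ?z"] Suc k by (simp add: add.commute)
  qed
  have phi_el: "\<phi> (el a v) = el (a * k) (f v)" if v: "v \<in> V" for a v
  proof -
    have "\<phi> (el a v) = \<phi> (el a ?z) * \<phi> (el 0 v)"
      unfolding el_split[OF v, of a] using v by (intro phi_mult) simp_all
    then show ?thesis using el_split[OF f(1)[OF v], of "a * k"] a0 f(2)[OF v] by simp
  qed
  have f_add: "f (v + w) = f v + f w" if v: "v \<in> V" and w: "w \<in> V" for v w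
  proof -
    have "el 0 (f (v + w)) = el 0 (f v) * el 0 (f w)"
      using phi_mult[of "el 0 v" "el 0 w"] v w f(2) by (simp add: el_0_mult)
    then show ?thesis using v w f(1) by (simp add: el_0_mult el_eq_iff)
  qed
  have f_M: "f (M *\<^sub>v v) = M ^\<^sub>m k *\<^sub>v f v" if v: "v \<in> V" for v
  proof -
    \<comment> \<open>This is M^(-k) f(M v). Splitting \<open>el 1 v\<close> as
      \<open>el 0 (M *\<^sub>v v) * el 1 ?z\<close> and applying \<open>\<phi>\<close> shows that it
      equals f v.\<close>
    let ?u = "M ^\<^sub>m ((q - 1) * k) *\<^sub>v f (M *\<^sub>v v)"
    have Mv: "M *\<^sub>v v \<in> V" using v by simp
    have u: "?u \<in> V" using f(1)[OF Mv] by (intro mat_intros)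
    have fM: "f (M *\<^sub>v v) = M ^\<^sub>m k *\<^sub>v ?u"
      using f(1)[OF Mv] M_pow_inverse(2)[of k] by (metis mat_vec_assoc M_pow_carrier one_mult_mat_vec)
    have "el 1 v = el 0 (M *\<^sub>v v) * el 1 ?z" using el_mult_zero[OF v, of 1] by simp
    then have "el k (f v) = el 0 (f (M *\<^sub>v v)) * el k ?z"
      using phi_mult[of "el 0 (M *\<^sub>v v)" "el 1 ?z"] phi_el[OF v, of 1] f(2)[OF Mv] k Mv by simp
    also have "\<dots> = el k ?u"
      using el_mult_zero[OF u, of k] unfolding fM[symmetric] .
    finally have fv: "f v = ?u" using el_eq_iff[OF f(1)[OF v] u] by blast
    show ?thesis unfolding fv by (rule fM)
  qed
  \<comment> \<open>Needed below to cancel \<open>k\<close> modulo \<open>q\<close> when exponents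
    are compared.\<close>
  have k_ndvd: "\<not> q dvd k"
  proof
    assume "q dvd k"
    then have "\<phi> (el 1 ?z) = \<phi> (el 0 ?z)"
      unfolding k phi_one by (intro el_cong) (simp add: cong_0_iff)
    then have "el 1 ?z = el 0 ?z" by (rule phi_inj[rotated 2]) simp_all
    then have "[1 = 0] (mod q)" using el_eq_iff[of ?z ?z 1 0] by simp
    then show False using q_gt_1 by (simp add: cong_def)
  qed
  have f_last: "f v $ (p - 1) = v $ (p - 1)" if v: "v \<in> V" for v
  proof -
    have J0: "v + J ^\<^sub>m c *\<^sub>v ?z = v" if "v \<in> V" for v c using that by simp
    \<comment> \<open>Circle multiplication of (0, v) by (1, 0) on the right writes the last
      coordinate of \<open>v\<close> into the exponent \<open>p ^ lastc v\<close>, where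
      \<open>\<phi>\<close> has to respect it.\<close>
    have "el 0 v \<otimes>\<^bsub>B\<^esub> el 1 ?z = el (p ^ lastc v) v"
      using circ_el[OF v zero_carrier_vec, of 0 1] J0[OF v] by simp
    moreover have "el 0 (f v) \<otimes>\<^bsub>B\<^esub> el k ?z = el (p ^ lastc (f v) * k) (f v)"
      using circ_el[OF f(1)[OF v] zero_carrier_vec, of 0 k] J0[OF f(1)[OF v]] by simp
    ultimately have "el (p ^ lastc v * k) (f v) = el (p ^ lastc (f v) * k) (f v)"
      using phi_circ[of "el 0 v" "el 1 ?z"] f(2)[OF v] k v phi_el[OF v] by simp
    then have "[k * p ^ lastc v = k * p ^ lastc (f v)] (mod q)"
      using f(1)[OF v] by (simp add: el_eq_iff mult.commute)
    then have "[lastc v = lastc (f v)] (mod p)"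
      using cong_cancel[OF k_ndvd] p_pow_cong_iff by blast
    then show ?thesis by (metis of_nat_lastc of_nat_eq_iff_cong)
  qed
  let ?e = "unit_vec p (p - 1) :: 'p mod_ring vec"
  have e: "?e \<in> V" by simp
  have f_J: "f (J *\<^sub>v v) = J *\<^sub>v f v" if v: "v \<in> V" for v
  proof -
    have Jv: "J *\<^sub>v v \<in> V" "J *\<^sub>v f v \<in> V" using v f(1) by simp_all
    have le: "lastc (f ?e) = 1" using f_last[OF e] p_gt_0 by (intro lastc_1) simp
    \<comment> \<open>A left factor with last coordinate 1 applies \<open>J\<close> once. By
      \<open>f_last\<close> the image of \<open>?e\<close> is again such a factor.\<close>
    have "el 0 ?e \<otimes>\<^bsub>B\<^esub> el 0 v = el 0 (?e + J *\<^sub>v v)"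
      unfolding circ_el[OF e v] lastc_unit_vec by simp
    moreover have "el 0 (f ?e) \<otimes>\<^bsub>B\<^esub> el 0 (f v) = el 0 (f ?e + J *\<^sub>v f v)"
      unfolding circ_el[OF f(1)[OF e] f(1)[OF v]] le by simp
    ultimately have "el 0 (f (?e + J *\<^sub>v v)) = el 0 (f ?e + J *\<^sub>v f v)"
      using phi_circ[OF el_in_N[OF e] el_in_N[OF v], of 0 0] f(2)[OF e] f(2)[OF v]
        f(2)[OF vec_add_closed[OF e Jv(1)]] by metis
    then have "f ?e + f (J *\<^sub>v v) = f ?e + J *\<^sub>v f v"
      using el_eq_iff[of "f (?e + J *\<^sub>v v)" "f ?e + J *\<^sub>v f v" 0 0] f(1) e Jv by (simp add: f_add)
    then show ?thesis by (rule vec_cong_addI[of _ _ _ p]) (use f(1) e Jv in simp_all)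
  qed
  interpret f: jordan_commuting p f
    by unfold_locales (use f(1) f_add f_J f_last in auto)
  have f_M_pow: "f (M ^\<^sub>m a *\<^sub>v v) = M ^\<^sub>m (k * a) *\<^sub>v f v" if v: "v \<in> V" for a v
  proof (induct a)
    case 0
    show ?case using v f(1) by simp
  next
    case (Suc a)
    have "M ^\<^sub>m Suc a *\<^sub>v v = M *\<^sub>v (M ^\<^sub>m a *\<^sub>v v)" using M_pow_add_vec[OF v, of 1 a] by simp
    then have "f (M ^\<^sub>m Suc a *\<^sub>v v) = M ^\<^sub>m k *\<^sub>v f (M ^\<^sub>m a *\<^sub>v v)" using f_M v by simp
    then show ?case using Suc M_pow_add_vec[OF f(1)[OF v], of k "k * a"] by simp
  qed
  \<comment> \<open>Each application of \<open>f\<close> raises the current power of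
    \<open>M\<close> to the k-th. At \<open>n = p\<close> the iterate is the identity, which gives M
    = M^(k^p).\<close>
  have "(f ^^ n) (M *\<^sub>v v) = M ^\<^sub>m (k ^ n) *\<^sub>v (f ^^ n) v" if v: "v \<in> V" for n v
    by (induct n) (use v f_M_pow in simp_all)
  from this[of _ p] have "M *\<^sub>v v = M ^\<^sub>m (k ^ p) *\<^sub>v v" if "v \<in> V" for v
    using that jordan_commuting_funpow_prime[OF f.jordan_commuting_axioms p card_p] by simp
  then have "M = M ^\<^sub>m (k ^ p)" by (intro eq_mat_mult_vecI[of _ p p]) simp_all
  then have "[k ^ p = 1] (mod q)" using M_pow_eq_iff[of "k ^ p" 1] by simp
  then obtain j where j: "j < p" and kj: "[k = p ^ j] (mod q)"
    using pth_root_cong_power[OF p q q_dvd] by blast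
  let ?K = "{v \<in> V. f v = J ^\<^sub>m j *\<^sub>v v}"
  have "?K = V"
  proof (rule M_irreducible)
    have f_uminus: "f (- v) = - f v" if v: "v \<in> V" for v
    proof (rule vec_cong_addI[of _ _ _ p])
      show "f v + f (- v) = f v + - f v"
        using f_add[OF v, of "- v"] v f(1) f.map_zero by (simp add: vec_minus_self)
    qed (use v f(1) in simp_all)
    show "vec_subgroup ?K"
      by (rule vec_subgroupI) (auto simp: f_add f.map_zero f_uminus mat_vec_add mat_vec_uminus)
    show "M *\<^sub>v v \<in> ?K" if "v \<in> ?K" for v
    proof -
      have v: "v \<in> V" "f v = J ^\<^sub>m j *\<^sub>v v" using that by auto
      \<comment> \<open>With k = p^j modulo \<open>q\<close>, both \<open>f\<close> and J^j carry
        \<open>M\<close> to the same power of \<open>M\<close>, so their equalizer is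
        \<open>M\<close>-invariant.\<close>
      have "f (M *\<^sub>v v) = M ^\<^sub>m (p ^ j * 1) *\<^sub>v (J ^\<^sub>m j *\<^sub>v v)"
        using f_M[OF v(1)] v(2) M_pow_eq_iff[of k "p ^ j"] kj by simp
      also have "\<dots> = (M ^\<^sub>m (p ^ j * 1) * J ^\<^sub>m j) *\<^sub>v v"
        using v(1) by (intro mat_vec_assoc[symmetric] mat_intros)
      also have "\<dots> = (J ^\<^sub>m j * M ^\<^sub>m 1) *\<^sub>v v" by (simp only: J_pow_M_pow)
      also have "\<dots> = J ^\<^sub>m j *\<^sub>v (M ^\<^sub>m 1 *\<^sub>v v)"
        using v(1) by (intro mat_vec_assoc mat_intros)
      finally show ?thesis using v(1) by simp
    qed
    \<comment> \<open>The required nonzero vector of \<open>?K\<close> is e_1, which both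
      \<open>f\<close> and J^j fix.\<close>
    have "J *\<^sub>v unit_vec p 0 = unit_vec p 0"
      using jordan_commuting.map_first_unit_vec[OF jordan_commuting_jordan_block] p_gt_0 by blast
    then have "(((*\<^sub>v) J) ^^ j) (unit_vec p 0) = unit_vec p 0" by (induct j) simp_all
    then have "J ^\<^sub>m j *\<^sub>v unit_vec p 0 = unit_vec p 0"
      by (simp add: pow_mat_mult_vec[of _ p])
    then show "unit_vec p 0 \<in> ?K" using f.map_first_unit_vec p_gt_0 by simp
    show "unit_vec p 0 \<noteq> (0\<^sub>v p :: 'p mod_ring vec)"
      using p_gt_0 by (metis index_unit_vec(1) index_zero_vec(1) zero_neq_one)
  qed
  then have fJ: "f v = J ^\<^sub>m j *\<^sub>v v" if "v \<in> V" for v using that by blast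
  have "\<phi> = sigma j"
  proof (rule extensionalityI[of _ "carrier N"])
    show "\<phi> \<in> extensional (carrier N)" "sigma j \<in> extensional (carrier N)"
      using phi_N sigma_auto by (auto simp: auto_def Bij_def)
    fix R assume "R \<in> carrier N"
    then obtain a v where R: "R = el a v" and v: "v \<in> V" by (auto simp: carrier_N)
    have "[k * a = p ^ j * a] (mod q)" using kj by (rule cong_scalar_right)
    then show "\<phi> R = sigma j R"
      unfolding R phi_el[OF v] sigma_el[OF v] fJ[OF v] by (intro el_cong) (simp add: mult.commute)
  qed
  then show ?thesis using j by blast
qed

end

section \<open>The group of skew brace automorphisms\<close>

lemma Aut_sb_simps:
  "carrier (Aut_sb N B) = auto N \<inter> auto B"
  "x \<otimes>\<^bsub>Aut_sb N B\<^esub> y = x \<otimes>\<^bsub>AutoGroup N\<^esub> y"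
  "\<one>\<^bsub>Aut_sb N B\<^esub> = \<one>\<^bsub>AutoGroup N\<^esub>"
  by (simp_all add: Aut_sb_def)

lemma carrier_Aut_sb: "carrier (Aut_sb N B) = sigma ` {..<p}"
  using phi_is_sigma sigma_auto sigma_auto_B by (auto simp: Aut_sb_simps)

lemma sigma_in_Aut_sb: "sigma j \<in> carrier (Aut_sb N B)"
  using sigma_auto sigma_auto_B by (simp add: Aut_sb_simps)

text \<open>Every element is some \<open>sigma i\<close>, so the group laws reduce to adding
  exponents modulo \<open>p\<close>.\<close>

lemma group_Aut_sb: "group (Aut_sb N B)"
proof (rule groupI)
  fix x y z assume "x \<in> carrier (Aut_sb N B)" "y \<in> carrier (Aut_sb N B)" "z \<in> carrier (Aut_sb N B)"
  then obtain i j l where "x = sigma i" "y = sigma j" "z = sigma l" by (auto simp: carrier_Aut_sb)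
  then show "x \<otimes>\<^bsub>Aut_sb N B\<^esub> y \<in> carrier (Aut_sb N B)"
    and "x \<otimes>\<^bsub>Aut_sb N B\<^esub> y \<otimes>\<^bsub>Aut_sb N B\<^esub> z = x \<otimes>\<^bsub>Aut_sb N B\<^esub> (y \<otimes>\<^bsub>Aut_sb N B\<^esub> z)"
    using sigma_in_Aut_sb by (simp_all only: Aut_sb_simps(2) sigma_mult add.assoc)
next
  show "\<one>\<^bsub>Aut_sb N B\<^esub> \<in> carrier (Aut_sb N B)"
    using sigma_in_Aut_sb[of 0] by (simp only: Aut_sb_simps(3) sigma_0)
next
  fix x assume "x \<in> carrier (Aut_sb N B)"
  then obtain j where x: "x = sigma j" by (auto simp: carrier_Aut_sb)
  show "\<one>\<^bsub>Aut_sb N B\<^esub> \<otimes>\<^bsub>Aut_sb N B\<^esub> x = x"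
    by (simp only: x Aut_sb_simps(2,3) sigma_0[symmetric] sigma_mult add_0)
  have "sigma ((p - 1) * j) \<otimes>\<^bsub>Aut_sb N B\<^esub> x = sigma ((p - 1) * j + j)"
    by (simp only: x Aut_sb_simps(2) sigma_mult)
  also have "\<dots> = sigma 0"
    by (intro sigma_cong) (simp only: pred_mult_add[OF p_gt_0] cong_def mod_mult_self1_is_0 mod_0)
  finally have "sigma ((p - 1) * j) \<otimes>\<^bsub>Aut_sb N B\<^esub> x = \<one>\<^bsub>Aut_sb N B\<^esub>"
    by (simp only: sigma_0 Aut_sb_simps(3))
  then show "\<exists>y\<in>carrier (Aut_sb N B). y \<otimes>\<^bsub>Aut_sb N B\<^esub> x = \<one>\<^bsub>Aut_sb N B\<^esub>"
    using sigma_in_Aut_sb by blast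
qed

lemma order_Aut_sb: "Coset.order (Aut_sb N B) = p"
proof -
  have "inj_on sigma {..<p}"
    by (rule inj_onI) (use sigma_inj cong_less_modulus_unique_nat in blast)
  then show ?thesis by (simp add: Coset.order_def carrier_Aut_sb card_image)
qed

lemma Aut_sb_generated: "carrier (Aut_sb N B) = generate (Aut_sb N B) {sigma 1}"
proof
  have "sigma j \<in> generate (Aut_sb N B) {sigma 1}" for j
  proof (induct j)
    case 0
    show ?case using generate.one[of "Aut_sb N B"] by (simp only: sigma_0 Aut_sb_simps(3))
  next
    case (Suc j)
    have "sigma j \<otimes>\<^bsub>Aut_sb N B\<^esub> sigma 1 \<in> generate (Aut_sb N B) {sigma 1}"
      using Suc by (rule generate.eng) (rule generate.incl, simp)
    then show ?case by (simp only: Aut_sb_simps(2) sigma_mult Suc_eq_plus1)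
  qed
  then show "carrier (Aut_sb N B) \<subseteq> generate (Aut_sb N B) {sigma 1}"
    by (auto simp: carrier_Aut_sb)
  show "generate (Aut_sb N B) {sigma 1} \<subseteq> carrier (Aut_sb N B)"
    using group.generate_incl[OF group_Aut_sb] sigma_in_Aut_sb by blast
qed

end

theorem theorem5p1:
  fixes p q :: nat
    and M :: "'p::prime_card mod_ring mat"
  assumes "Factorial_Ring.prime p" and "Factorial_Ring.prime q"
    and "CARD('p) = p"
    and "q dvd (p ^ p - 1) div (p - 1)"
    and "M \<in> carrier (GL p)"
    and "group.ord (GL p) M = q"
    and "jordan_block p 1 \<otimes>\<^bsub>GL p\<^esub> M \<otimes>\<^bsub>GL p\<^esub> inv\<^bsub>GL p\<^esub> (jordan_block p 1) = M [^]\<^bsub>GL p\<^esub> p"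
  shows "Coset.order (Aut_sb (N_group p q M) (B_circ p q M)) = p \<and>
    carrier (Aut_sb (N_group p q M) (B_circ p q M)) =
      generate (Aut_sb (N_group p q M) (B_circ p q M))
        {conj_N p q M (blk (jordan_block p 1) (0\<^sub>v p))}"
proof -
  interpret brace_setup p q M by unfold_locales (fact assms)+
  show ?thesis using order_Aut_sb Aut_sb_generated unfolding sigma_1 by simp
qed

end
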